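(* Let $d\ge 1$, and let $T$, $K$, $X_1,\dots,X_{2d-1}$ and $B_{2d}$ be as in the context. Define coefficients $\alpha_{\mathbf n}$, $\mathbf n\in\mathbb{N}_0^{2d-1}$, with unspecified values $\alpha_{\mathbf e_1},\dots,\alpha_{\mathbf e_{2d-1}}$ (regarded as indeterminates), as follows: $\alpha_{\boldsymbol 0}=0$; for $\mathbf n=n_\ell\mathbf e_\ell$ with $n_\ell\ge1$, $1\le\ell\le 2d-1$, $$\alpha_{\mathbf n}=\frac{\alpha_{\mathbf e_\ell}^{n_\ell}X_\ell^{2(n_\ell-1)}(1-X_\ell^{n_\ell(2d-1)})}{(1-X_\ell^{2d-1})(1-X_\ell^2)^{n_\ell-1}(1-X_\ell^{2d+1})^{n_\ell-1}};$$ and for all other $\mathbf n$ (at least two nonzero coordinates) recursively by $$\alpha_{\mathbf n}\Big(-\frac{1}{zT^{2d-1}}+\sum_{\ell=1}^{d}\big(\mathbf X^{(2\ell-1)\mathbf n}+\mathbf X^{(-2\ell+1)\mathbf n}\big)\Big)=\sum_{\ell=2}^{2d}(-1)^\ell\sum_{\mathbf g_1+\dots+\mathbf g_\ell=\mathbf n}\Big(\prod_{k=1}^{\ell}\alpha_{\mathbf g_k}\Big)\sum_{\{b_1<\dots<b_\ell\}\subseteq B_{2d}}\ \prod_{k=1}^{\ell}\mathbf X^{b_k\mathbf g_k},$$ where the middle sum is over ordered tuples of vectors $\mathbf g_k\in\mathbb{N}_0^{2d-1}\setminus\{\boldsymbol 0\}$. For $j\in\mathbb{Z}$ put $\rho_j=\sum_{\mathbf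 n\in\mathbb{N}_0^{2d-1}}\alpha_{\mathbf n}\mathbf X^{j\mathbf n}$. Then the formal power series $T_j=T(1-\rho_j)$ satisfies $$T_j=1+z\prod_{\ell=1}^{d}\big(T_{j+2\ell-1}\,T_{j-2\ell+1}\big),\qquad j\in\mathbb{Z}.$$
   Context: $T=T(z)$ is the formal power series with $T(0)=1$ and $T=1+zT^{2d}$ (generating function of $2d$-ary trees). $K=\bigcup_{m\ge1}\mathbb{C}((z^{1/m}))$ is the field of Puiseux series in $z$. $X_1,\dots,X_{2d-1}\in K$ are the $2d-1$ small solutions (those of positive order in $z$, i.e. tending to $0$ as $z\to0$) of the characteristic equation $$1=zT^{2d-1}\sum_{\ell=1}^{d}\big(X^{2\ell-1}+X^{-2\ell+1}\big).$$ $B_{2d}=\{-(2d-1),-(2d-3),\dots,2d-3,2d-1\}$ (odd integers). Notation: $\mathbb{N}_0=\{0,1,2,\dots\}$; $\mathbf e_\ell$ is the $\ell$-th unit vector of $\mathbb{N}_0^{2d-1}$; for $\mathbf n=(n_1,\dots,n_{2d-1})$ and $m\in\mathbb{Z}$, $\mathbf X^{m\mathbf n}=X_1^{mn_1}\cdots X_{2d-1}^{mn_{2d-1}}$. Each $\alpha_{\mathbf n}$ is an element of $K$ times the monomial $\prod_\ell\alpha_{\mathbf e_\ell}^{n_\ell}$, and $\rho_j,T_j$ are regarded as formal power series in the indeterminates $\alpha_{\mathbf e_1},\dots,\alpha_{\mathbf e_{2d-1}}$ with coefficients in $K$. *)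

theory Defs
  imports
    "HOL-Computational_Algebra.Computational_Algebra"
    "HOL-Library.Poly_Mapping"
begin

section \<open>Puiseux series\<close>

lemma fls_compose_power_compose:
  assumes "m > 0" "n > 0"
  shows "fls_compose_power (fls_compose_power f m) n = fls_compose_power f (m * n)"
proof (rule fls_eqI)
  fix k :: int
  have *: "int (m * n) dvd k \<longleftrightarrow> int n dvd k \<and> int m dvd k div int n"
  proof (cases "int n dvd k")
    case True
    then obtain q where "k = int n * q" by auto
    thus ?thesis using assms by (simp add: mult.commute[of "int m"])
  next
    case False
    thus ?thesis using dvd_mult_right[of "int m" "int n" k] by auto
  qed
  have "k div int n div int m = k div int (m * n)"
    using assms by (simp add: zdiv_zmult2_eq mult.commute[of "int m"])
  thus "fls_nth (fls_compose_power (fls_compose_power f m) n) k = fls_nth (fls_compose_power f (m * n)) k"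
    using assms * by (simp add: fls_nth_compose_power)
qed

lemma fls_compose_power_inject:
  assumes "m > 0" "fls_compose_power f m = fls_compose_power g m"
  shows "f = g"
proof (rule fls_eqI)
  fix k :: int
  have "fls_nth (fls_compose_power f m) (int m * k) = fls_nth (fls_compose_power g m) (int m * k)"
    using assms(2) by simp
  thus "fls_nth f k = fls_nth g k"
    using assms(1) by (simp add: fls_nth_compose_power)
qed

lemma fls_compose_power_eq_0_iff:
  "m > 0 \<Longrightarrow> fls_compose_power f m = 0 \<longleftrightarrow> f = 0"
  using fls_compose_power_inject[of m f 0] by auto

lemma fls_compose_power_inverse:
  fixes f :: "'a :: field fls"
  assumes "m > 0"
  shows "fls_compose_power (inverse f) m = inverse (fls_compose_power f m)"
proof (cases "f = 0")
  case False
  have "fls_compose_power f m * fls_compose_power (inverse f) m = 1"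
    using False assms by (simp flip: fls_compose_power_mult)
  thus ?thesis by (metis inverse_unique)
qed simp

lemma fls_subdegree_compose_power:
  assumes "m > 0"
  shows "fls_subdegree (fls_compose_power f m) = int m * fls_subdegree f"
proof (cases "f = 0")
  case False
  show ?thesis
  proof (rule fls_subdegree_eqI)
    show "fls_nth (fls_compose_power f m) (int m * fls_subdegree f) \<noteq> 0"
      using False assms by (simp add: fls_nth_compose_power)
    fix k assume k: "k < int m * fls_subdegree f"
    show "fls_nth (fls_compose_power f m) k = 0"
    proof (cases "int m dvd k")
      case True
      then obtain q where q: "k = int m * q" by auto
      hence "q < fls_subdegree f" using k assms by simp
      thus ?thesis using q assms by (simp add: fls_nth_compose_power)
    qed (use assms in \<open>simp add: fls_nth_compose_power\<close>)
  qed
qed simp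

text \<open>
  The pair \<open>(m, f)\<close> stands for the series \<open>f(z\<^sup>1\<^sup>/\<^sup>m)\<close>; after raising both roots to a common
  denominator, \<open>(m, f)\<close> and \<open>(n, g)\<close> denote the same series iff \<open>f(w\<^sup>n) = g(w\<^sup>m)\<close>.
\<close>

definition puiseux_rel :: "nat \<times> 'a :: zero fls \<Rightarrow> nat \<times> 'a fls \<Rightarrow> bool" where
  "puiseux_rel p q \<longleftrightarrow> fst p > 0 \<and> fst q > 0 \<and>
     fls_compose_power (snd p) (fst q) = fls_compose_power (snd q) (fst p)"

lemma part_equivp_puiseux_rel: "part_equivp puiseux_rel"
proof (rule part_equivpI)
  show "\<exists>x. puiseux_rel x (x :: nat \<times> 'a fls)"
    by (rule exI[of _ "(1, 0)"]) (simp add: puiseux_rel_def)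
  show "symp puiseux_rel"
    by (auto simp: symp_def puiseux_rel_def)
  show "transp (puiseux_rel :: nat \<times> 'a fls \<Rightarrow> _)"
  proof (rule transpI)
    fix x y z :: "nat \<times> 'a fls"
    assume xy: "puiseux_rel x y" and yz: "puiseux_rel y z"
    obtain m f n g p h where [simp]: "x = (m, f)" "y = (n, g)" "z = (p, h)"
      by (metis surj_pair)
    have pos: "m > 0" "n > 0" "p > 0"
      and 1: "fls_compose_power f n = fls_compose_power g m"
      and 2: "fls_compose_power g p = fls_compose_power h n"
      using xy yz by (auto simp: puiseux_rel_def)
    have "fls_compose_power (fls_compose_power f p) n = fls_compose_power (fls_compose_power f n) p"
      using pos by (simp add: fls_compose_power_compose mult.commute)
    also have "\<dots> = fls_compose_power (fls_compose_power g p) m"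
      using pos by (simp add: 1 fls_compose_power_compose mult.commute)
    also have "\<dots> = fls_compose_power (fls_compose_power h m) n"
      using pos by (simp add: 2 fls_compose_power_compose mult.commute)
    finally have "fls_compose_power f p = fls_compose_power h m"
      using pos fls_compose_power_inject by blast
    thus "puiseux_rel x z" using pos by (simp add: puiseux_rel_def)
  qed
qed

quotient_type (overloaded) 'a puiseux = "nat \<times> 'a :: zero fls" / partial: puiseux_rel
  by (rule part_equivp_puiseux_rel)

lemma puiseux_rel_iff:
  "puiseux_rel (m, f) (n, g) \<longleftrightarrow>
     m > 0 \<and> n > 0 \<and> fls_compose_power f n = fls_compose_power g m"
  by (simp add: puiseux_rel_def)

lemma puiseux_rel_binop:
  assumes "puiseux_rel (m, f) (m', f')" "puiseux_rel (n, g) (n', g')"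
  shows "fls_compose_power (fls_compose_power f n) (m' * n') =
         fls_compose_power (fls_compose_power f' n') (m * n)"
    and "fls_compose_power (fls_compose_power g m) (m' * n') =
         fls_compose_power (fls_compose_power g' m') (m * n)"
proof -
  have pos: "m > 0" "m' > 0" "n > 0" "n' > 0"
    and 1: "fls_compose_power f m' = fls_compose_power f' m"
    and 2: "fls_compose_power g n' = fls_compose_power g' n"
    using assms by (auto simp: puiseux_rel_iff)
  have "fls_compose_power (fls_compose_power f n) (m' * n') =
        fls_compose_power (fls_compose_power f m') (n * n')"
    using pos by (simp add: fls_compose_power_compose mult_ac)
  also have "\<dots> = fls_compose_power (fls_compose_power f' n') (m * n)"
    using pos by (simp add: 1 fls_compose_power_compose mult_ac)
  finally show "fls_compose_power (fls_compose_power f n) (m' * n') =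
                fls_compose_power (fls_compose_power f' n') (m * n)" .
  have "fls_compose_power (fls_compose_power g m) (m' * n') =
        fls_compose_power (fls_compose_power g n') (m * m')"
    using pos by (simp add: fls_compose_power_compose mult_ac)
  also have "\<dots> = fls_compose_power (fls_compose_power g' m') (m * n)"
    using pos by (simp add: 2 fls_compose_power_compose mult_ac)
  finally show "fls_compose_power (fls_compose_power g m) (m' * n') =
                fls_compose_power (fls_compose_power g' m') (m * n)" .
qed

lemma puiseux_rel_plus:
  fixes f g f' g' :: "'a :: field fls"
  assumes "puiseux_rel (m, f) (m', f')" "puiseux_rel (n, g) (n', g')"
  shows "puiseux_rel (m * n, fls_compose_power f n + fls_compose_power g m)
                     (m' * n', fls_compose_power f' n' + fls_compose_power g' m')"
  using assms puiseux_rel_binop[OF assms] by (simp add: puiseux_rel_iff)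

lemma puiseux_rel_minus:
  fixes f g f' g' :: "'a :: field fls"
  assumes "puiseux_rel (m, f) (m', f')" "puiseux_rel (n, g) (n', g')"
  shows "puiseux_rel (m * n, fls_compose_power f n - fls_compose_power g m)
                     (m' * n', fls_compose_power f' n' - fls_compose_power g' m')"
  using assms puiseux_rel_binop[OF assms] by (simp add: puiseux_rel_iff)

lemma puiseux_rel_times:
  fixes f g f' g' :: "'a :: field fls"
  assumes "puiseux_rel (m, f) (m', f')" "puiseux_rel (n, g) (n', g')"
  shows "puiseux_rel (m * n, fls_compose_power f n * fls_compose_power g m)
                     (m' * n', fls_compose_power f' n' * fls_compose_power g' m')"
  using assms puiseux_rel_binop[OF assms] by (simp add: puiseux_rel_iff)

instantiation puiseux :: (field) field
begin

lift_definition zero_puiseux :: "'a puiseux" is "(1, 0)"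
  by (simp add: puiseux_rel_iff)

lift_definition one_puiseux :: "'a puiseux" is "(1, 1)"
  by (simp add: puiseux_rel_iff)

lift_definition plus_puiseux :: "'a puiseux \<Rightarrow> 'a puiseux \<Rightarrow> 'a puiseux" is
  "\<lambda>(m, f) (n, g). (m * n, fls_compose_power f n + fls_compose_power g m)"
  by (clarsimp simp: puiseux_rel_plus)

lift_definition minus_puiseux :: "'a puiseux \<Rightarrow> 'a puiseux \<Rightarrow> 'a puiseux" is
  "\<lambda>(m, f) (n, g). (m * n, fls_compose_power f n - fls_compose_power g m)"
  by (clarsimp simp: puiseux_rel_minus)

lift_definition uminus_puiseux :: "'a puiseux \<Rightarrow> 'a puiseux" is
  "\<lambda>(m, f). (m, - f)"
  by (auto simp: puiseux_rel_iff)

lift_definition times_puiseux :: "'a puiseux \<Rightarrow> 'a puiseux \<Rightarrow> 'a puiseux" is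
  "\<lambda>(m, f) (n, g). (m * n, fls_compose_power f n * fls_compose_power g m)"
  by (clarsimp simp: puiseux_rel_times)

lift_definition inverse_puiseux :: "'a puiseux \<Rightarrow> 'a puiseux" is
  "\<lambda>(m, f). (m, inverse f)"
  by (auto simp: puiseux_rel_iff fls_compose_power_inverse)

definition divide_puiseux :: "'a puiseux \<Rightarrow> 'a puiseux \<Rightarrow> 'a puiseux" where
  "divide_puiseux x y = x * inverse y"

instance
proof
  fix a b c :: "'a puiseux"
  show "a * b * c = a * (b * c)"
    by transfer (auto simp: puiseux_rel_iff fls_compose_power_compose mult_ac)
  show "a * b = b * a"
    by transfer (auto simp: puiseux_rel_iff mult_ac)
  show "1 * a = a"
    by transfer (auto simp: puiseux_rel_iff fls_compose_power_compose)
  show "a + b + c = a + (b + c)"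
    by transfer (auto simp: puiseux_rel_iff fls_compose_power_compose mult_ac add_ac)
  show "a + b = b + a"
    by transfer (auto simp: puiseux_rel_iff mult_ac add_ac)
  show "0 + a = a"
    by transfer (auto simp: puiseux_rel_iff fls_compose_power_compose)
  show "- a + a = 0"
    by transfer (auto simp: puiseux_rel_iff)
  show "a - b = a + - b"
    by transfer (auto simp: puiseux_rel_iff)
  show "(a + b) * c = a * c + b * c"
    by transfer (auto simp: puiseux_rel_iff fls_compose_power_compose algebra_simps)
  show "(0 :: 'a puiseux) \<noteq> 1"
    by transfer (auto simp: puiseux_rel_iff)
  show "inverse (0 :: 'a puiseux) = 0"
    by transfer (auto simp: puiseux_rel_iff)
  show "a div b = a * inverse b"
    by (simp add: divide_puiseux_def)
  show "inverse a * a = 1" if "a \<noteq> 0"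
    using that
    by transfer (auto simp: puiseux_rel_iff fls_compose_power_eq_0_iff simp flip: fls_compose_power_mult)
qed

end

definition puiseux_of_fls :: "'a :: field fls \<Rightarrow> 'a puiseux" where
  "puiseux_of_fls f = abs_puiseux (1, f)"

abbreviation puiseux_of_fps :: "'a :: field fps \<Rightarrow> 'a puiseux" where
  "puiseux_of_fps f \<equiv> puiseux_of_fls (fps_to_fls f)"

text \<open>As for \<^const>\<open>fls_subdegree\<close>, the order of \<open>0\<close> is \<open>0\<close> by convention (not \<open>\<infinity>\<close>).\<close>

lift_definition puiseux_order :: "'a :: field puiseux \<Rightarrow> rat" is
  "\<lambda>(m, f). of_int (fls_subdegree f) / of_nat m"
proof clarify
  fix m n :: nat and f g :: "'a fls"
  assume *: "puiseux_rel (m, f) (n, g)"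
  hence "int n * fls_subdegree f = int m * fls_subdegree g"
    by (metis puiseux_rel_iff fls_subdegree_compose_power)
  hence "(of_int (int n * fls_subdegree f) :: rat) = of_int (int m * fls_subdegree g)"
    by simp
  thus "(of_int (fls_subdegree f) :: rat) / of_nat m = of_int (fls_subdegree g) / of_nat n"
    using * by (simp add: puiseux_rel_iff field_simps)
qed


section \<open>Formal power series in several indeterminates\<close>

text \<open>
  Indeterminates are indexed by \<open>'v\<close>; an exponent vector is a finitely supported map
  \<open>'v \<Rightarrow>\<^sub>0 nat\<close>, and a series is an arbitrary family of coefficients.
\<close>

typedef ('v, 'a) mfps = "UNIV :: (('v \<Rightarrow>\<^sub>0 nat) \<Rightarrow> 'a) set"
  morphisms mfps_nth Abs_mfps ..

setup_lifting type_definition_mfps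

lemma mfps_eq_iff: "f = g \<longleftrightarrow> (\<forall>n. mfps_nth f n = mfps_nth g n)"
  by transfer auto

lemma finite_exponent_decomp: "finite {(g, h). g + h = (n :: 'v \<Rightarrow>\<^sub>0 nat)}"
proof -
  let ?F = "{f :: 'v \<Rightarrow> nat. \<forall>x. (x \<in> Poly_Mapping.keys n \<longrightarrow> f x \<in> {..Max (insert 0 (range (Poly_Mapping.lookup n)))}) \<and>
              (x \<notin> Poly_Mapping.keys n \<longrightarrow> f x = 0)}"
  have fin_range: "finite (range (Poly_Mapping.lookup n))"
    by (rule finite_subset[of _ "insert 0 (Poly_Mapping.lookup n ` Poly_Mapping.keys n)"]) (auto simp: in_keys_iff)
  have le: "Poly_Mapping.lookup g x \<le> Max (insert 0 (range (Poly_Mapping.lookup n)))" if "g + h = n" for g h x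
  proof -
    have "Poly_Mapping.lookup g x \<le> Poly_Mapping.lookup n x" using that by (auto simp: lookup_add)
    also have "\<dots> \<le> Max (insert 0 (range (Poly_Mapping.lookup n)))" using fin_range by (intro Max_ge) auto
    finally show ?thesis .
  qed
  have fin: "finite ?F" by (rule finite_set_of_finite_funs) auto
  have "Poly_Mapping.lookup ` {g. \<exists>h. g + h = n} \<subseteq> ?F"
  proof (clarify, intro conjI impI)
    fix h g x assume n: "n = g + h"
    show "Poly_Mapping.lookup g x \<in> {..Max (insert 0 (range (Poly_Mapping.lookup (g + h))))}"
      using le[of g h x] n by simp
    assume "x \<notin> Poly_Mapping.keys (g + h)"
    thus "Poly_Mapping.lookup g x = 0" by (simp add: in_keys_iff lookup_add)
  qed
  hence "finite (Poly_Mapping.lookup ` {g. \<exists>h. g + h = n})" using fin finite_subset by blast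
  hence "finite {g. \<exists>h. g + h = n}"
    by (rule finite_imageD) (auto simp: inj_on_def lookup_inject)
  hence "finite ((\<lambda>g. (g, n - g)) ` {g. \<exists>h. g + h = n})" by (rule finite_imageI)
  thus ?thesis by (rule finite_subset[rotated]) (auto simp: image_iff)
qed

instantiation mfps :: (type, comm_ring_1) comm_ring_1
begin

lift_definition zero_mfps :: "('a, 'b) mfps" is "\<lambda>_. 0" .
lift_definition one_mfps :: "('a, 'b) mfps" is "\<lambda>n. if n = 0 then 1 else 0" .
lift_definition plus_mfps :: "('a, 'b) mfps \<Rightarrow> ('a, 'b) mfps \<Rightarrow> ('a, 'b) mfps" is
  "\<lambda>f g n. f n + g n" .
lift_definition minus_mfps :: "('a, 'b) mfps \<Rightarrow> ('a, 'b) mfps \<Rightarrow> ('a, 'b) mfps" is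
  "\<lambda>f g n. f n - g n" .
lift_definition uminus_mfps :: "('a, 'b) mfps \<Rightarrow> ('a, 'b) mfps" is "\<lambda>f n. - f n" .
lift_definition times_mfps :: "('a, 'b) mfps \<Rightarrow> ('a, 'b) mfps \<Rightarrow> ('a, 'b) mfps" is
  "\<lambda>f g n. \<Sum>(h, k) | h + k = n. f h * g k" .

instance
proof
  fix a b c :: "('a, 'b) mfps"
  show "a * b * c = a * (b * c)"
  proof (transfer, rule ext)
    fix f g h :: "('a \<Rightarrow>\<^sub>0 nat) \<Rightarrow> 'b" and n :: "'a \<Rightarrow>\<^sub>0 nat"
    let ?L = "SIGMA p:{(u, w). u + w = n}. {(v, v'). v + v' = fst p}"
    let ?R = "SIGMA p:{(u, w). u + w = n}. {(v, v'). v + v' = snd p}"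
    have "(\<Sum>(u, w) | u + w = n. (\<Sum>(v, v') | v + v' = u. f v * g v') * h w) =
          (\<Sum>(p, q)\<in>?L. f (fst q) * g (snd q) * h (snd p))"
      by (subst sum.Sigma[symmetric])
         (auto simp: finite_exponent_decomp finite_exponent_decomp[unfolded case_prod_unfold] sum_distrib_right case_prod_unfold)
    also have "\<dots> = (\<Sum>(p, q)\<in>?R. f (fst p) * (g (fst q) * h (snd q)))"
      by (rule sum.reindex_bij_witness
           [where i = "\<lambda>((u, w), (v, v')). ((u + v, v'), (u, v))"
              and j = "\<lambda>((u, w), (v, v')). ((v, v' + w), (v', w))"])
         (auto simp: add_ac mult_ac)
    also have "\<dots> = (\<Sum>(u, w) | u + w = n. f u * (\<Sum>(v, v') | v + v' = w. g v * h v'))"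
      by (subst sum.Sigma[symmetric])
         (auto simp: finite_exponent_decomp finite_exponent_decomp[unfolded case_prod_unfold] sum_distrib_left case_prod_unfold)
    finally show "(\<Sum>(u, w) | u + w = n. (\<Sum>(v, v') | v + v' = u. f v * g v') * h w) =
                  (\<Sum>(u, w) | u + w = n. f u * (\<Sum>(v, v') | v + v' = w. g v * h v'))" .
  qed
  show "a * b = b * a"
  proof (transfer, rule ext)
    fix f g :: "('a \<Rightarrow>\<^sub>0 nat) \<Rightarrow> 'b" and n :: "'a \<Rightarrow>\<^sub>0 nat"
    show "(\<Sum>(h, k) | h + k = n. f h * g k) = (\<Sum>(h, k) | h + k = n. g h * f k)"
      by (rule sum.reindex_bij_witness[where i = prod.swap and j = prod.swap])
         (auto simp: add.commute mult.commute)
  qed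
  show "1 * a = a"
  proof (transfer, rule ext)
    fix f :: "('a \<Rightarrow>\<^sub>0 nat) \<Rightarrow> 'b" and n :: "'a \<Rightarrow>\<^sub>0 nat"
    have "(\<Sum>(h, k) | h + k = n. (if h = 0 then 1 else 0) * f k) =
          (\<Sum>(h, k) \<in> {(0 :: 'a \<Rightarrow>\<^sub>0 nat, n)}. (if h = 0 then 1 else 0) * f k)"
      by (rule sum.mono_neutral_right) (auto simp: finite_exponent_decomp split: if_splits)
    thus "(\<Sum>(h, k) | h + k = n. (if h = 0 then 1 else 0) * f k) = f n" by simp
  qed
  show "(a + b) * c = a * c + b * c"
    by (transfer, rule ext)
       (simp add: case_prod_unfold distrib_right sum.distrib)
  show "a + b + c = a + (b + c)" by transfer (simp add: add_ac)
  show "a + b = b + a" by transfer (simp add: add_ac)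
  show "0 + a = a" by transfer simp
  show "- a + a = 0" by transfer simp
  show "a - b = a + - b" by transfer simp
  show "(0 :: ('a, 'b) mfps) \<noteq> 1" by transfer (auto simp: fun_eq_iff)
qed

end

lift_definition mfps_const :: "'a :: zero \<Rightarrow> ('v, 'a) mfps" is
  "\<lambda>c n. if n = 0 then c else 0" .

lift_definition mfps_var :: "'v \<Rightarrow> ('v, 'a :: zero_neq_one) mfps" is
  "\<lambda>v n. if n = Poly_Mapping.single v 1 then 1 else 0" .

text \<open>
  The formal sum of a family that is locally finite, i.e. in which every monomial occurs in only
  finitely many members; it is only meaningful for such families.
\<close>

lift_definition mfps_formal_sum ::
    "('i \<Rightarrow> ('v, 'a :: comm_monoid_add) mfps) \<Rightarrow> 'i set \<Rightarrow> ('v, 'a) mfps" is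
  "\<lambda>f A n. \<Sum>i | i \<in> A \<and> f i n \<noteq> 0. f i n" .


section \<open>The characteristic equation and its small solutions\<close>

abbreviation pz :: "complex puiseux" where
  "pz \<equiv> puiseux_of_fls fls_X"

definition small_solutions :: "nat \<Rightarrow> complex fps \<Rightarrow> complex puiseux set" where
  "small_solutions d T = {x. x \<noteq> 0 \<and> puiseux_order x > 0 \<and>
     1 = pz * puiseux_of_fps T ^ (2 * d - 1) *
         (\<Sum>l=1..d. x powi (2 * int l - 1) + x powi (- (2 * int l) + 1))}"

definition B_set :: "nat \<Rightarrow> int set" where
  "B_set m = {b. odd b \<and> \<bar>b\<bar> \<le> int m - 1}"

definition exponents :: "nat \<Rightarrow> (nat \<Rightarrow>\<^sub>0 nat) set" where
  "exponents d = {n. Poly_Mapping.keys n \<subseteq> {1..2 * d - 1}}"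

definition Xpow :: "nat \<Rightarrow> (nat \<Rightarrow> complex puiseux) \<Rightarrow> int \<Rightarrow> (nat \<Rightarrow>\<^sub>0 nat) \<Rightarrow> complex puiseux" where
  "Xpow d X m n = (\<Prod>l=1..2 * d - 1. X l powi (m * int (Poly_Mapping.lookup n l)))"

definition tuples_summing_to :: "nat \<Rightarrow> nat \<Rightarrow> (nat \<Rightarrow>\<^sub>0 nat) \<Rightarrow> (nat \<Rightarrow>\<^sub>0 nat) list set" where
  "tuples_summing_to d l n =
     {gs. length gs = l \<and> set gs \<subseteq> exponents d - {0} \<and> sum_list gs = n}"

text \<open>An \<open>l\<close>-element subset of \<open>B\<close> is listed as its strictly increasing enumeration.\<close>

definition increasing_tuples :: "nat \<Rightarrow> int set \<Rightarrow> int list set" where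
  "increasing_tuples l B = {bs. length bs = l \<and> sorted_wrt (<) bs \<and> set bs \<subseteq> B}"

end

theory Submission
  imports Defs
begin

text \<open>
  Comparing coefficients at an exponent vector with at least two nonzero entries, the claimed
  functional equation is the recursion for \<open>\<alpha>\<close> once \<open>\<Prod>(1 - \<rho>)\<close> is expanded over increasing tuples;
  the factor of \<open>\<alpha>\<^sub>n\<close> in the recursion is nonzero because a product of at least
  two small solutions is never a small solution, so that \<open>\<alpha>\<^sub>n\<close> is a scalar multiple of the monomial with exponent \<open>n\<close>.
  On an axis, where only one indeterminate occurs, the explicit coefficients sum to the rational function
  \<open>1 - \<rho>\<^sub>j = (1 - v x\<^bsup>-2\<^esup>)(1 - v x\<^bsup>2d+1\<^esup>) / ((1 - v)(1 - v x\<^bsup>2d-1\<^esup>))\<close> with \<open>v\<close> proportional to \<open>x\<^sup>j\<close>,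
  and the product over \<open>B\<^bsub>2d\<^esub>\<close> telescopes.
\<close>

section \<open>The order of Puiseux series\<close>

lemma fls_compose_power_Suc_0 [simp]: "fls_compose_power f (Suc 0) = f"
  by (rule fls_eqI) (simp add: fls_nth_compose_power)

lemma puiseux_order_mult:
  fixes x y :: "'a :: field puiseux"
  assumes "x \<noteq> 0" "y \<noteq> 0"
  shows "puiseux_order (x * y) = puiseux_order x + puiseux_order y"
  using assms
  by transfer
     (auto simp: puiseux_rel_iff fls_compose_power_eq_0_iff fls_subdegree_compose_power
        field_simps split: prod.splits)

text \<open>In a representing series \<open>1 - f\<close> the constant term 1 cannot cancel when
  \<open>f\<close> starts at a positive exponent, so it is the leading term. This serves both to
  compute orders and to show that denominators do not vanish.\<close>

lemma puiseux_order_1_minus: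
  fixes x :: "'a :: field puiseux"
  assumes "puiseux_order x > 0"
  shows "1 - x \<noteq> 0" "puiseux_order (1 - x) = 0"
proof -
  have *: "fls_subdegree (1 - f) = 0 \<and> 1 - f \<noteq> 0" if "fls_subdegree f > 0" for f :: "'a fls"
  proof -
    have "fls_nth (1 - f) 0 = 1" using that by simp
    moreover have "fls_subdegree (1 - f) = 0"
      by (rule fls_subdegree_eqI) (use that in auto)
    ultimately show ?thesis by auto
  qed
  have "1 - x \<noteq> 0 \<and> puiseux_order (1 - x) = 0"
    using assms
    by transfer (auto simp: puiseux_rel_iff fls_compose_power_eq_0_iff zero_less_divide_iff
          dest!: * split: prod.splits)
  thus "1 - x \<noteq> 0" "puiseux_order (1 - x) = 0" by auto
qed

lemma puiseux_order_1 [simp]: "puiseux_order (1 :: 'a :: field puiseux) = 0"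
  by transfer auto

lemma puiseux_order_power:
  fixes x :: "'a :: field puiseux"
  assumes "x \<noteq> 0"
  shows "puiseux_order (x ^ n) = of_nat n * puiseux_order x"
  using assms by (induction n) (auto simp: puiseux_order_mult algebra_simps)

lemma puiseux_order_prod:
  fixes f :: "'b \<Rightarrow> 'a :: field puiseux"
  assumes "\<And>i. i \<in> A \<Longrightarrow> f i \<noteq> 0"
  shows "puiseux_order (\<Prod>i\<in>A. f i) = (\<Sum>i\<in>A. puiseux_order (f i))"
  using assms by (induction A rule: infinite_finite_induct) (auto simp: puiseux_order_mult)

section \<open>Laurent series inside the Puiseux field\<close>

lemma puiseux_order_of_fls: "puiseux_order (puiseux_of_fls f) = of_int (fls_subdegree f)"
proof -
  have "Quotient3 puiseux_rel abs_puiseux rep_puiseux" by (rule Quotient3_puiseux)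
  show ?thesis unfolding puiseux_of_fls_def
    by (subst puiseux_order.abs_eq) (auto simp: puiseux_rel_iff)
qed

lemma puiseux_of_fls_eq_0_iff: "puiseux_of_fls f = 0 \<longleftrightarrow> f = 0"
  unfolding puiseux_of_fls_def zero_puiseux.abs_eq
  using Quotient3_rel[OF Quotient3_puiseux, of "(1, f)" "(1, 0)"]
  by (auto simp: puiseux_rel_iff)

lemma puiseux_of_fls_1: "puiseux_of_fls 1 = 1"
  by (simp add: puiseux_of_fls_def one_puiseux_def)

lemma puiseux_of_fls_add: "puiseux_of_fls (f + g) = puiseux_of_fls f + puiseux_of_fls g"
  unfolding puiseux_of_fls_def
  by (subst plus_puiseux.abs_eq) (auto simp: puiseux_rel_iff eq_onp_def)

lemma puiseux_of_fls_mult: "puiseux_of_fls (f * g) = puiseux_of_fls f * puiseux_of_fls g"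
  unfolding puiseux_of_fls_def
  by (subst times_puiseux.abs_eq) (auto simp: puiseux_rel_iff eq_onp_def)

lemma puiseux_of_fls_power: "puiseux_of_fls (f ^ n) = puiseux_of_fls f ^ n"
  by (induction n) (simp_all add: puiseux_of_fls_1 puiseux_of_fls_mult)

text \<open>Multiplication by \<open>y - inverse y\<close> turns each odd power of \<open>y\<close>
  into the difference of its two even neighbours, and these differences telescope over the odd
  exponents from -(2d-1) to 2d-1. This gives the characteristic equation a closed form.\<close>

lemma sum_powi_telescope:
  fixes y :: "'a :: field"
  assumes "y \<noteq> 0"
  shows "(\<Sum>l=1..d. y powi (2 * int l - 1) + y powi (- (2 * int l) + 1)) * (y - inverse y) =
         y powi (2 * int d) - y powi (- 2 * int d)"
proof (induction d)
  case (Suc d)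
  define a b where "a = y powi (2 * int d)" and "b = y powi - (2 * int d)"
  have 1: "y powi (2 * int (Suc d) - 1) = a * y"
    using power_int_add[of y "2 * int d" 1] assms by (simp add: a_def algebra_simps)
  have 2: "y powi (1 - 2 * int (Suc d)) = b * inverse y"
    using power_int_add[of y "- (2 * int d)" "- 1"] assms
    by (simp add: b_def algebra_simps power_int_minus)
  have 3: "y powi (2 * int (Suc d)) = a * y * y"
    using power_int_add[of y "2 * int d" 2] assms
    by (simp add: a_def algebra_simps power2_eq_square)
  have 4: "y powi - (2 * int (Suc d)) = b * inverse y * inverse y"
    using power_int_add[of y "- (2 * int d)" "- 2"] assms
    by (simp add: b_def algebra_simps power_int_minus power2_eq_square)
  have 5: "(a * y + b * inverse y) * (y - inverse y) = a * y * y - a + b - b * inverse y * inverse y"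
    using assms by (simp add: field_simps)
  thus ?case
    using Suc.IH by (simp add: 1 2 3 4 5 distrib_right[of "sum _ _"] del: of_nat_Suc flip: a_def b_def)
qed simp

text \<open>Multiplying by \<open>x - inverse x\<close> and clearing negative exponents gives
  \<open>(1 - x ^ 2) * x ^ (2 * d - 1) = w * (1 - x ^ (4 * d))\<close>, where
  \<open>1 - x ^ 2\<close> and \<open>1 - x ^ (4 * d)\<close> have order 0. Since \<open>x\<close>
  is arbitrary, this can also be applied to products of solutions.\<close>

lemma puiseux_order_characteristic_solution:
  fixes x w :: "'a :: field puiseux"
  assumes x: "x \<noteq> 0" "puiseux_order x > 0"
    and eq: "1 = w * (\<Sum>l=1..d. x powi (2 * int l - 1) + x powi (- (2 * int l) + 1))"
  shows "of_nat (2 * d - 1) * puiseux_order x = puiseux_order w"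
proof -
  \<comment> \<open>An empty sum would make the equation read 1 = 0. With \<open>d\<close> positive,
    the truncated subtraction \<open>2 * d - 1\<close> is a true one.\<close>
  have d: "d \<ge> 1" using eq by (cases d) auto
  have w: "w \<noteq> 0" using eq by auto
  have pow: "puiseux_order (x ^ n) > 0" if "n > 0" for n
    using x that by (simp add: puiseux_order_power)
  have "x - inverse x = w * (x powi (2 * int d) - x powi (- 2 * int d))"
    unfolding sum_powi_telescope[OF x(1), of d, symmetric] mult.assoc[symmetric] eq[symmetric]
    by (rule mult_1[symmetric])
  hence 1: "(x - inverse x) * x ^ (2 * d) = w * ((x powi (2 * int d) - x powi (- 2 * int d)) * x ^ (2 * d))"
    by simp
  have 2: "(x - inverse x) * x ^ (2 * d) = - ((1 - x ^ 2) * x ^ (2 * d - 1))"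
  proof -
    have "x ^ (2 * d) = x * x ^ (2 * d - 1)"
      using d by (cases d) simp_all
    thus ?thesis using x(1) by (simp add: algebra_simps power2_eq_square)
  qed
  have 3: "(x powi (2 * int d) - x powi (- 2 * int d)) * x ^ (2 * d) = - (1 - x ^ (4 * d))"
  proof -
    have "x powi (2 * int d) = x ^ (2 * d)"
      using power_int_of_nat[of x "2 * d"] by simp
    moreover from this have "x powi (- 2 * int d) = inverse (x ^ (2 * d))"
      using power_int_minus[of x "2 * int d"] by simp
    moreover have "x ^ (4 * d) = x ^ (2 * d) * x ^ (2 * d)"
      by (simp flip: power_add)
    ultimately show ?thesis using x(1) by (simp add: left_diff_distrib)
  qed
  have "(1 - x ^ 2) * x ^ (2 * d - 1) = w * (1 - x ^ (4 * d))"
    using 1 unfolding 2 3 mult_minus_right by (rule neg_equal_iff_equal[THEN iffD1])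
  hence "puiseux_order ((1 - x ^ 2) * x ^ (2 * d - 1)) = puiseux_order (w * (1 - x ^ (4 * d)))"
    by simp
  thus ?thesis
    using x w pow d puiseux_order_1_minus[of "x ^ 2"] puiseux_order_1_minus[of "x ^ (4 * d)"]
    by (simp add: puiseux_order_mult puiseux_order_power)
qed


section \<open>Coefficients of multivariate series\<close>

lemma mfps_nth_0 [simp]: "mfps_nth 0 n = 0"
  by (simp add: zero_mfps.rep_eq)

lemma mfps_nth_1: "mfps_nth 1 n = (if n = 0 then 1 else 0)"
  by (simp add: one_mfps.rep_eq)

lemma mfps_nth_add [simp]: "mfps_nth (f + g) n = mfps_nth f n + mfps_nth g n"
  by (simp add: plus_mfps.rep_eq)

lemma mfps_nth_diff [simp]: "mfps_nth (f - g) n = mfps_nth f n - mfps_nth g n"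
  by (simp add: minus_mfps.rep_eq)

lemma mfps_nth_uminus [simp]: "mfps_nth (- f) n = - mfps_nth f n"
  by (simp add: uminus_mfps.rep_eq)

lemma mfps_nth_mult:
  "mfps_nth (f * g) n = (\<Sum>(h, k) | h + k = n. mfps_nth f h * mfps_nth g k)"
  by (simp only: times_mfps.rep_eq)

lemma mfps_nth_sum: "mfps_nth (\<Sum>i\<in>A. f i) n = (\<Sum>i\<in>A. mfps_nth (f i) n)"
  by (induction A rule: infinite_finite_induct) auto

lemma mfps_nth_minus_one_power_mult:
  "mfps_nth ((- 1) ^ l * f) n = (- 1) ^ l * mfps_nth f n"
  by (induction l) simp_all

text \<open>A single term. Constants and indeterminates are both of this shape, so that their
  products all reduce to adding exponents.\<close>

definition mfps_monom :: "('v \<Rightarrow>\<^sub>0 nat) \<Rightarrow> 'a :: zero \<Rightarrow> ('v, 'a) mfps" where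
  "mfps_monom m c = Abs_mfps (\<lambda>n. if n = m then c else 0)"

lemma mfps_nth_monom: "mfps_nth (mfps_monom m c) n = (if n = m then c else 0)"
  by (simp add: mfps_monom_def Abs_mfps_inverse)

lemma mfps_const_conv_monom: "mfps_const c = mfps_monom 0 c"
  by (simp add: mfps_eq_iff mfps_nth_monom mfps_const.rep_eq)

lemma mfps_var_conv_monom: "mfps_var v = mfps_monom (Poly_Mapping.single v 1) 1"
  by (simp add: mfps_eq_iff mfps_nth_monom mfps_var.rep_eq)

lemma mfps_monom_0_1: "mfps_monom 0 1 = 1"
  by (simp add: mfps_eq_iff mfps_nth_monom mfps_nth_1)

text \<open>By cancellation the index set on the right has at most one element; the form as a sum
  also covers the case where it is empty.\<close>

lemma mfps_nth_monom_mult: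
  "mfps_nth (mfps_monom m c * f) n = (\<Sum>k | m + k = n. c * mfps_nth f k)"
proof -
  have "mfps_nth (mfps_monom m c * f) n =
        (\<Sum>(h, k) \<in> {(h, k). h + k = n \<and> h = m}. c * mfps_nth f k)"
    unfolding mfps_nth_mult
    by (rule sum.mono_neutral_cong_right)
       (auto simp: finite_exponent_decomp mfps_nth_monom split: if_splits)
  also have "\<dots> = (\<Sum>k | m + k = n. c * mfps_nth f k)"
    by (rule sum.reindex_bij_witness[of _ "Pair m" snd]) auto
  finally show ?thesis .
qed

lemma mfps_nth_const_mult: "mfps_nth (mfps_const c * f) n = c * mfps_nth f n"
  unfolding mfps_const_conv_monom mfps_nth_monom_mult by simp

lemma mfps_nth_mult_const: "mfps_nth (f * mfps_const c) n = mfps_nth f n * c"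
  using mfps_nth_const_mult[of c f n] by (simp only: mult.commute)

lemma mfps_monom_mult: "mfps_monom m c * mfps_monom n d = mfps_monom (m + n) (c * d)"
  unfolding mfps_eq_iff
proof
  fix N
  show "mfps_nth (mfps_monom m c * mfps_monom n d) N = mfps_nth (mfps_monom (m + n) (c * d)) N"
  proof (cases "N = m + n")
    case True
    hence "{k. m + k = N} = {n}" by auto
    thus ?thesis using True by (simp add: mfps_nth_monom_mult mfps_nth_monom)
  next
    case False
    have "(\<Sum>k | m + k = N. c * mfps_nth (mfps_monom n d) k) = 0"
      by (rule sum.neutral) (use False in \<open>auto simp: mfps_nth_monom\<close>)
    thus ?thesis using False by (simp add: mfps_nth_monom_mult mfps_nth_monom)
  qed
qed

lemma mfps_monom_add: "mfps_monom m c + mfps_monom m d = mfps_monom m (c + d)"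
  by (simp add: mfps_eq_iff mfps_nth_monom)

lemma mfps_monom_0 [simp]: "mfps_monom m 0 = 0"
  by (simp add: mfps_eq_iff mfps_nth_monom)

lemma mfps_monom_sum: "(\<Sum>i\<in>A. mfps_monom m (f i)) = mfps_monom m (\<Sum>i\<in>A. f i)"
  by (induction A rule: infinite_finite_induct) (auto simp: mfps_monom_add)

lemma mfps_minus_one_power_mult_monom:
  "(- 1) ^ l * mfps_monom m c = mfps_monom m ((- 1) ^ l * c)"
  unfolding mfps_eq_iff mfps_nth_minus_one_power_mult mfps_nth_monom by simp

lemma mfps_monom_single_power: "mfps_monom (Poly_Mapping.single v 1) 1 ^ k = mfps_monom (Poly_Mapping.single v k) 1"
  by (induction k) (simp_all add: mfps_monom_0_1 mfps_monom_mult flip: single_add)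

lemma mfps_monom_prod_nth:
  "(\<Prod>k<length gs. mfps_monom (gs ! k) (c (gs ! k))) = mfps_monom (sum_list gs) (\<Prod>k<length gs. c (gs ! k))"
  by (induction gs) (simp_all add: mfps_monom_0_1 prod.lessThan_Suc_shift mfps_monom_mult del: prod.lessThan_Suc)

text \<open>Every entry is a summand of \<open>n\<close>, hence comes from a finite set, and the
  length is fixed.\<close>

lemma finite_lists_sum_exponent:
  "finite {gs :: ('v \<Rightarrow>\<^sub>0 nat) list. length gs = l \<and> sum_list gs = n}"
proof (rule finite_subset)
  have "{g. \<exists>h. g + h = n} = fst ` {(g, h). g + h = n}" by force
  thus "finite {gs. set gs \<subseteq> {g. \<exists>h. g + h = n} \<and> length gs = l}"
    by (intro finite_lists_length_eq) (simp add: finite_exponent_decomp)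
  have "\<exists>h. g + h = sum_list gs" if "g \<in> set gs" for g and gs :: "('v \<Rightarrow>\<^sub>0 nat) list"
    using sum_list_map_remove1[OF that, of id] by (intro exI[of _ "sum_list (remove1 g gs)"]) simp
  thus "{gs. length gs = l \<and> sum_list gs = n} \<subseteq>
        {gs. set gs \<subseteq> {g. \<exists>h. g + h = n} \<and> length gs = l}"
    by auto
qed

text \<open>Iterated convolution, peeling off the first factor. Zero entries are still allowed in
  the lists; they drop out later, for factors without constant term.\<close>

lemma mfps_nth_prod_lessThan:
  "mfps_nth (\<Prod>k<l. f k) n =
   (\<Sum>gs | length gs = l \<and> sum_list gs = n. \<Prod>k<l. mfps_nth (f k) (gs ! k))"
proof (induction l arbitrary: f n)
  case 0
  have "{gs. length gs = 0 \<and> sum_list gs = n} = (if n = 0 then {[]} else {})"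
    by auto
  thus ?case by (simp add: mfps_nth_1)
next
  case (Suc l)
  have "mfps_nth (\<Prod>k<Suc l. f k) n = mfps_nth (f 0 * (\<Prod>k<l. f (Suc k))) n"
    by (simp add: prod.lessThan_Suc_shift del: prod.lessThan_Suc)
  also have "\<dots> = (\<Sum>p | fst p + snd p = n. \<Sum>gs | length gs = l \<and> sum_list gs = snd p.
                     mfps_nth (f 0) (fst p) * (\<Prod>k<l. mfps_nth (f (Suc k)) (gs ! k)))"
    by (simp add: mfps_nth_mult Suc.IH case_prod_unfold sum_distrib_left)
  also have "\<dots> = (\<Sum>(p, gs) \<in> (SIGMA p:{p. fst p + snd p = n}. {gs. length gs = l \<and> sum_list gs = snd p}).
                     mfps_nth (f 0) (fst p) * (\<Prod>k<l. mfps_nth (f (Suc k)) (gs ! k)))"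
    by (rule sum.Sigma)
       (use finite_exponent_decomp[of n] in \<open>auto simp: finite_lists_sum_exponent case_prod_unfold\<close>)
  also have "\<dots> = (\<Sum>gs | length gs = Suc l \<and> sum_list gs = n.
                     mfps_nth (f 0) (hd gs) * (\<Prod>k<l. mfps_nth (f (Suc k)) (tl gs ! k)))"
    \<comment> \<open>The second summand of the split is the sum of the tail, so the pair of split
      and tail carries the same information as the list of length \<open>Suc l\<close>.\<close>
    by (rule sum.reindex_bij_witness
          [where i = "\<lambda>gs. ((hd gs, sum_list (tl gs)), tl gs)" and j = "\<lambda>((h, k), gs). h # gs"])
       (auto simp: length_Suc_conv)
  also have "\<dots> = (\<Sum>gs | length gs = Suc l \<and> sum_list gs = n. \<Prod>k<Suc l. mfps_nth (f k) (gs ! k))"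
    by (rule sum.cong)
       (auto simp: length_Suc_conv prod.lessThan_Suc_shift simp del: prod.lessThan_Suc)
  finally show ?case .
qed

lemma mfps_const_mult: "mfps_const c * mfps_const d = mfps_const (c * d)"
  by (simp add: mfps_const_conv_monom mfps_monom_mult)

lemma mfps_const_power: "mfps_const c ^ k = mfps_const (c ^ k)"
  by (induction k) (simp_all add: mfps_const_mult, simp add: mfps_const_conv_monom mfps_monom_0_1)

text \<open>The univariate series left after setting all indeterminates other than \<open>v\<close>
  to 0.\<close>

definition mfps_axis :: "'v \<Rightarrow> ('v, 'a) mfps \<Rightarrow> 'a fps" where
  "mfps_axis v f = Abs_fps (\<lambda>k. mfps_nth f (Poly_Mapping.single v k))"

lemma fps_nth_mfps_axis: "fps_nth (mfps_axis v f) k = mfps_nth f (Poly_Mapping.single v k)"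
  by (simp add: mfps_axis_def)

lemma single_eq_0_iff: "Poly_Mapping.single v k = 0 \<longleftrightarrow> k = 0"
  by (metis lookup_single_eq lookup_zero single_zero)

lemma mfps_axis_1 [simp]: "mfps_axis v 1 = 1"
  by (rule fps_ext) (simp add: fps_nth_mfps_axis mfps_nth_1 single_eq_0_iff)

lemma mfps_axis_const [simp]: "mfps_axis v (mfps_const c) = fps_const c"
  by (rule fps_ext) (auto simp: fps_nth_mfps_axis mfps_const_conv_monom mfps_nth_monom single_eq_0_iff)

lemma mfps_axis_add [simp]: "mfps_axis v (f + g) = mfps_axis v f + mfps_axis v g"
  by (rule fps_ext) (simp add: fps_nth_mfps_axis)

lemma mfps_axis_diff [simp]: "mfps_axis v (f - g) = mfps_axis v f - mfps_axis v g"
  by (rule fps_ext) (simp add: fps_nth_mfps_axis)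

text \<open>Exponents are nonnegative, so both summands of a vector on an axis lie on that axis, and
  the multivariate convolution there is the univariate one.\<close>

lemma mfps_axis_mult [simp]:
  fixes v :: 'v
  shows "mfps_axis v (f * g) = mfps_axis v f * mfps_axis v g"
proof (rule fps_ext)
  fix n
  have axis: "h = Poly_Mapping.single v (Poly_Mapping.lookup h v)"
    if "h + k = Poly_Mapping.single v n" for h k :: "'v \<Rightarrow>\<^sub>0 nat"
  proof (rule poly_mapping_eqI)
    fix w
    have "Poly_Mapping.lookup h w + Poly_Mapping.lookup k w = Poly_Mapping.lookup (Poly_Mapping.single v n) w"
      by (simp flip: that lookup_add)
    thus "Poly_Mapping.lookup h w = Poly_Mapping.lookup (Poly_Mapping.single v (Poly_Mapping.lookup h v)) w"
      by (cases "w = v") (auto simp: lookup_single)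
  qed
  have "fps_nth (mfps_axis v (f * g)) n =
        (\<Sum>(h, k) | h + k = Poly_Mapping.single v n. mfps_nth f h * mfps_nth g k)"
    by (simp add: fps_nth_mfps_axis mfps_nth_mult)
  also have "\<dots> = (\<Sum>i=0..n. mfps_nth f (Poly_Mapping.single v i) * mfps_nth g (Poly_Mapping.single v (n - i)))"
  proof (rule sum.reindex_bij_witness
      [where i = "\<lambda>i. (Poly_Mapping.single v i, Poly_Mapping.single v (n - i))"
         and j = "\<lambda>(h, k). Poly_Mapping.lookup h v"])
    fix p assume p: "p \<in> {(h, k). h + k = Poly_Mapping.single v n}"
    obtain h k where [simp]: "p = (h, k)" by force
    have sum: "h + k = Poly_Mapping.single v n" using p by simp
    hence n: "n = Poly_Mapping.lookup h v + Poly_Mapping.lookup k v"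
      by (metis lookup_add lookup_single_eq)
    have h: "Poly_Mapping.single v (Poly_Mapping.lookup h v) = h" using axis[OF sum] by simp
    have "Poly_Mapping.single v (Poly_Mapping.lookup k v) = k"
      using axis[of k h] sum by (simp add: add.commute)
    hence k: "Poly_Mapping.single v (n - Poly_Mapping.lookup h v) = k" by (simp add: n)
    show "(case p of (h, k) \<Rightarrow> Poly_Mapping.lookup h v) \<in> {0..n}" using n by simp
    show "(Poly_Mapping.single v (case p of (h, k) \<Rightarrow> Poly_Mapping.lookup h v),
           Poly_Mapping.single v (n - (case p of (h, k) \<Rightarrow> Poly_Mapping.lookup h v))) = p"
      using h k by simp
    show "mfps_nth f (Poly_Mapping.single v (case p of (h, k) \<Rightarrow> Poly_Mapping.lookup h v)) *
          mfps_nth g (Poly_Mapping.single v (n - (case p of (h, k) \<Rightarrow> Poly_Mapping.lookup h v))) =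
          (case p of (h, k) \<Rightarrow> mfps_nth f h * mfps_nth g k)"
      using h k by simp
  qed (auto simp flip: single_add)
  also have "\<dots> = fps_nth (mfps_axis v f * mfps_axis v g) n"
    by (simp add: fps_mult_nth fps_nth_mfps_axis)
  finally show "fps_nth (mfps_axis v (f * g)) n = fps_nth (mfps_axis v f * mfps_axis v g) n" .
qed

lemma mfps_axis_prod: "mfps_axis v (\<Prod>i\<in>A. f i) = (\<Prod>i\<in>A. mfps_axis v (f i))"
  by (induction A rule: infinite_finite_induct) auto


section \<open>Products over increasing tuples\<close>

lemma finite_B_set: "finite (B_set m)"
proof (rule finite_subset)
  show "B_set m \<subseteq> {- int m..int m}" by (auto simp: B_set_def)
qed simp

lemma B_set_Suc:
  "B_set (2 * Suc d) = insert (2 * int d + 1) (insert (- 1 - 2 * int d) (B_set (2 * d)))"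
proof (rule set_eqI)
  fix b :: int
  have "odd b \<and> \<bar>b\<bar> \<le> int (2 * Suc d) - 1 \<longleftrightarrow>
        b = 2 * int d + 1 \<or> b = - 1 - 2 * int d \<or> odd b \<and> \<bar>b\<bar> \<le> int (2 * d) - 1"
  proof (cases "odd b")
    case True
    then obtain k where "b = 2 * k + 1" by (rule oddE)
    thus ?thesis by (simp; arith)
  next
    case False
    hence "b \<noteq> 2 * int d + 1" "b \<noteq> - 1 - 2 * int d" by auto
    thus ?thesis using False by simp
  qed
  thus "b \<in> B_set (2 * Suc d) \<longleftrightarrow> b \<in> insert (2 * int d + 1) (insert (- 1 - 2 * int d) (B_set (2 * d)))"
    by (simp only: B_set_def mem_Collect_eq insert_iff)
qed

lemma B_set_Suc_notin:
  "2 * int d + 1 \<notin> B_set (2 * d)" "- 1 - 2 * int d \<notin> B_set (2 * d)"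
  "2 * int d + 1 \<noteq> - 1 - 2 * int d"
  by (simp_all add: B_set_def)

text \<open>Pairs \<open>b\<close> with \<open>- b\<close>. This links the product in the functional
  equation to the set from which the recursion draws its subsets.\<close>

lemma prod_B_set:
  fixes f :: "int \<Rightarrow> 'a :: comm_monoid_mult"
  shows "(\<Prod>b\<in>B_set (2 * d). f b) = (\<Prod>l=1..d. f (2 * int l - 1) * f (- (2 * int l) + 1))"
proof (induction d)
  case 0
  have "B_set 0 = {}" by (auto simp: B_set_def)
  thus ?case by simp
next
  case (Suc d)
  have "(\<Prod>b\<in>B_set (2 * Suc d). f b) = f (2 * int d + 1) * (f (- 1 - 2 * int d) * (\<Prod>b\<in>B_set (2 * d). f b))"
    unfolding B_set_Suc using B_set_Suc_notin[of d] by (simp add: finite_B_set)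
  thus ?case using Suc.IH by (simp add: algebra_simps)
qed

lemma sum_B_set:
  fixes f :: "int \<Rightarrow> 'a :: comm_monoid_add"
  shows "(\<Sum>b\<in>B_set (2 * d). f b) = (\<Sum>l=1..d. f (2 * int l - 1) + f (- (2 * int l) + 1))"
proof (induction d)
  case 0
  have "B_set 0 = {}" by (auto simp: B_set_def)
  thus ?case by simp
next
  case (Suc d)
  have "(\<Sum>b\<in>B_set (2 * Suc d). f b) = f (2 * int d + 1) + (f (- 1 - 2 * int d) + (\<Sum>b\<in>B_set (2 * d). f b))"
    unfolding B_set_Suc using B_set_Suc_notin[of d] by (simp add: finite_B_set)
  thus ?case using Suc.IH by (simp add: algebra_simps)
qed

lemma card_B_set: "card (B_set (2 * d)) = 2 * d"
  using sum_B_set[where f = "\<lambda>_. 1 :: nat"] by simp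

text \<open>Expand over all subsets of \<open>B\<close>, group them by cardinality, and list each
  subset through \<open>sorted_list_of_set\<close>.\<close>

lemma prod_one_minus_increasing_tuples:
  fixes r :: "int \<Rightarrow> 'a :: comm_ring_1"
  assumes "finite B"
  shows "(\<Prod>b\<in>B. 1 - r b) =
    (\<Sum>l\<le>card B. (- 1) ^ l * (\<Sum>bs\<in>increasing_tuples l B. \<Prod>k<l. r (bs ! k)))"
proof -
  have "(\<Prod>b\<in>B. 1 - r b) = (\<Sum>S\<in>Pow B. (- 1) ^ card S * (\<Prod>b\<in>S. r b))"
    using assms by (simp add: prod_diff_conv_sum)
  also have "\<dots> = (\<Sum>l\<le>card B. \<Sum>S | S \<in> Pow B \<and> card S = l. (- 1) ^ card S * (\<Prod>b\<in>S. r b))"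
    by (rule sum.group[symmetric]) (use assms in \<open>auto intro: card_mono\<close>)
  also have "\<dots> = (\<Sum>l\<le>card B. (- 1) ^ l * (\<Sum>bs\<in>increasing_tuples l B. \<Prod>k<l. r (bs ! k)))"
  proof (rule sum.cong[OF refl])
    fix l
    have "(\<Sum>S | S \<in> Pow B \<and> card S = l. (- 1) ^ card S * (\<Prod>b\<in>S. r b)) =
          (- 1) ^ l * (\<Sum>S | S \<in> Pow B \<and> card S = l. \<Prod>b\<in>S. r b)"
      by (simp add: sum_distrib_left)
    also have "(\<Sum>S | S \<in> Pow B \<and> card S = l. \<Prod>b\<in>S. r b) =
               (\<Sum>bs\<in>increasing_tuples l B. \<Prod>k<l. r (bs ! k))"
    proof (rule sum.reindex_bij_witness[where i = set and j = sorted_list_of_set])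
      fix S assume S: "S \<in> {S. S \<in> Pow B \<and> card S = l}"
      hence fin: "finite S" using assms finite_subset by auto
      show "set (sorted_list_of_set S) = S" using fin by simp
      show "sorted_list_of_set S \<in> increasing_tuples l B"
        using S fin by (auto simp: increasing_tuples_def)
      have "(\<Prod>k<l. r (sorted_list_of_set S ! k)) = prod_list (map r (sorted_list_of_set S))"
        using S by (simp add: prod.list_conv_set_nth atLeast0LessThan)
      also have "\<dots> = (\<Prod>b\<in>S. r b)"
        using fin by (simp flip: prod.distinct_set_conv_list)
      finally show "(\<Prod>k<l. r (sorted_list_of_set S ! k)) = (\<Prod>b\<in>S. r b)" .
    next
      fix bs assume bs: "bs \<in> increasing_tuples l B"
      show "sorted_list_of_set (set bs) = bs"
        using bs by (auto simp: increasing_tuples_def strict_sorted_equal)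
      show "set bs \<in> {S. S \<in> Pow B \<and> card S = l}"
        using bs by (auto simp: increasing_tuples_def distinct_card strict_sorted_iff)
    qed
    finally show "(\<Sum>S | S \<in> Pow B \<and> card S = l. (- 1) ^ card S * (\<Prod>b\<in>S. r b)) =
                  (- 1) ^ l * (\<Sum>bs\<in>increasing_tuples l B. \<Prod>k<l. r (bs ! k))" .
  qed
  finally show ?thesis .
qed


section \<open>The functional equation for one indeterminate\<close>

text \<open>Formally \<open>F j\<close> is the quotient \<open>L (j - 2) / L j\<close> times
  \<open>M (j + 2) / M j\<close>. Over the odd shifts between -(2m-1) and 2m-1 the first quotient
  telescopes downwards and the second upwards. Denominators are multiplied out so that the result
  applies to power series.\<close>

lemma prod_two_sided_telescope:
  fixes F L M :: "int \<Rightarrow> 'a :: idom"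
  assumes F: "\<And>j. F j * (L j * M j) = L (j - 2) * M (j + 2)"
    and nz: "\<And>j. L j \<noteq> 0" "\<And>j. M j \<noteq> 0"
  shows "(\<Prod>l=1..m. F (j + 2 * int l - 1) * F (j - 2 * int l + 1)) *
           (L (j + 2 * int m - 1) * M (j - 2 * int m + 1)) =
         L (j - 2 * int m - 1) * M (j + 2 * int m + 1)"
proof (induction m)
  case (Suc m)
  define p where "p = (\<Prod>l=1..m. F (j + 2 * int l - 1) * F (j - 2 * int l + 1))"
  define f g where "f = F (j + 2 * int m + 1)" and "g = F (j - 2 * int m - 1)"
  define a a' b b' where "a = L (j + 2 * int m - 1)" and "a' = L (j + 2 * int m + 1)"
    and "b = L (j - 2 * int m - 1)" and "b' = L (j - 2 * int m - 3)"
  define s s' t t' where "s = M (j - 2 * int m + 1)" and "s' = M (j - 2 * int m - 1)"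
    and "t = M (j + 2 * int m + 1)" and "t' = M (j + 2 * int m + 3)"
  have IH: "p * (a * s) = b * t"
    using Suc.IH by (simp add: p_def a_def s_def b_def t_def)
  have f: "f * (a' * t) = a * t'"
    using F[of "j + 2 * int m + 1"] by (simp add: f_def a'_def t_def a_def t'_def algebra_simps)
  have g: "g * (b * s') = b' * s"
    using F[of "j - 2 * int m - 1"] by (simp add: g_def b_def s'_def b'_def s_def algebra_simps)
  \<comment> \<open>The product of the three relations \<open>IH\<close>, \<open>f\<close> and
    \<open>g\<close> contains the claim times \<open>t * b * a * s\<close>, which is nonzero and
    cancels.\<close>
  have "(p * (f * g) * (a' * s')) * (t * b * a * s) = (p * (a * s)) * (f * (a' * t)) * (g * (b * s'))"
    by (simp only: mult_ac)
  also have "\<dots> = (b' * t') * (t * b * a * s)"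
    unfolding IH f g by (simp only: mult_ac)
  finally have "p * (f * g) * (a' * s') = b' * t'"
    using nz by (simp add: a_def b_def s_def t_def)
  moreover have "(\<Prod>l=1..Suc m. F (j + 2 * int l - 1) * F (j - 2 * int l + 1)) = p * (f * g)"
    by (simp add: p_def f_def g_def algebra_simps)
  ultimately show ?case
    by (simp add: a'_def s'_def b'_def t'_def algebra_simps)
qed simp

text \<open>The assumptions compare the coefficients of 1, \<open>W\<close> and
  \<open>W * W\<close>.\<close>

lemma factored_quadratic_eqI:
  fixes W :: "'a :: comm_ring_1"
  assumes "t0 = t1 + t2" "t0 * (p0 + q0) = t1 * (p1 + q1) + t2 * (p2 + q2) + c"
    and "t0 * (p0 * q0) = t1 * (p1 * q1) + t2 * (p2 * q2)"
  shows "t0 * ((1 - p0 * W) * (1 - q0 * W)) =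
         t1 * ((1 - p1 * W) * (1 - q1 * W)) + t2 * ((1 - p2 * W) * (1 - q2 * W)) - c * W"
proof -
  have *: "t * ((1 - p * W) * (1 - q * W)) = t - t * (p + q) * W + t * (p * q) * (W * W)" for t p q
    by (simp add: algebra_simps)
  show ?thesis unfolding * assms(2,3) unfolding assms(1) by (simp add: algebra_simps)
qed

lemma fps_geometric:
  fixes a :: "'a :: field"
  shows "Abs_fps (\<lambda>k. a ^ k) * (1 - fps_const a * fps_X) = 1"
proof (rule fps_ext)
  fix n
  show "fps_nth (Abs_fps (\<lambda>k. a ^ k) * (1 - fps_const a * fps_X)) n = fps_nth 1 n"
    by (cases n) (simp_all add: right_diff_distrib mult.assoc[symmetric] mult.commute[of _ a])
qed

lemma functional_equation_one_variable:
  fixes x z T :: "'a :: field" and R :: "int \<Rightarrow> 'a fps"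
  assumes d: "d \<ge> 1" and x: "x \<noteq> 0" "x ^ 2 \<noteq> 1" "x ^ (2 * d - 1) \<noteq> 1" "x ^ (2 * d + 1) \<noteq> 1"
    and T: "T = 1 + z * T ^ (2 * d)"
    and char: "1 = z * T ^ (2 * d - 1) *
         (\<Sum>l=1..d. x powi (2 * int l - 1) + x powi (- (2 * int l) + 1))"
    and R0: "\<And>j. fps_nth (R j) 0 = 0"
    and R: "\<And>j k. k \<ge> 1 \<Longrightarrow> fps_nth (R j) k =
         x ^ (2 * (k - 1)) * (1 - x ^ (k * (2 * d - 1))) /
           ((1 - x ^ (2 * d - 1)) * (1 - x ^ 2) ^ (k - 1) * (1 - x ^ (2 * d + 1)) ^ (k - 1)) *
         x powi (j * int k)"
  shows "fps_const T * (1 - R j) = 1 + fps_const z *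
           (\<Prod>l=1..d. (fps_const T * (1 - R (j + 2 * int l - 1))) * (fps_const T * (1 - R (j - 2 * int l + 1))))"
proof -
  define y where "y = x ^ (2 * d - 1)"
  \<comment> \<open>\<open>c\<close> is the ratio hidden in the axis coefficients: for k \<ge> 1 the
    hypothesis \<open>R\<close> says that the k-th coefficient of \<open>R j\<close> is
    \<open>c ^ (k - 1) * (1 - y ^ k) / (1 - y)\<close> times
    \<open>x powi (j * int k)\<close>.\<close>
  define c where "c = x ^ 2 / ((1 - x ^ 2) * (1 - x ^ (2 * d + 1)))"
  define L where "L e = 1 - fps_const (c * x powi e) * fps_X" for e
  have y: "y \<noteq> 0" "y \<noteq> 1" using x by (simp_all add: y_def)
  have y': "x ^ (2 * d + 1) = x ^ 2 * y"
    using d unfolding y_def power_add[symmetric] by (intro arg_cong[of _ _ "power x"]) simp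
  have xy: "x powi (2 * int d - 1) = y"
    using d power_int_of_nat[of x "2 * d - 1"] by (simp add: y_def of_nat_diff)
  have "x powi (2 + (2 * int d - 1)) = x powi 2 * x powi (2 * int d - 1)"
    using x by (intro power_int_add) simp
  hence e3: "x powi (2 + (2 * int d - 1)) = x ^ 2 * y"
    unfolding xy by simp
  have e4: "x powi - 2 = 1 / x ^ 2"
    by (simp add: power_int_minus_divide)
  have c: "c \<noteq> 0" using x by (simp add: c_def)
  have Lnz: "L e \<noteq> 0" for e
  proof
    assume "L e = 0"
    hence "fps_nth (L e) 0 = 0" by simp
    thus False by (simp add: L_def)
  qed
  \<comment> \<open>For fixed \<open>j\<close> every shift of \<open>L\<close> is linear in the one
    series \<open>W = fps_const (c * x powi j) * fps_X\<close>, so products of two shifts are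
    quadratics in \<open>W\<close>.\<close>
  have L_shift: "L (j + e) = 1 - fps_const (x powi e) * (fps_const (c * x powi j) * fps_X)" for j e
    using x by (simp add: L_def power_int_add mult_ac flip: fps_const_mult)
  have F: "(1 - R j) * (L j * L (j + (2 * int d - 1))) = L (j - 2) * L (j + 2 + (2 * int d - 1))" for j
  proof -
    define G where "G a = Abs_fps (\<lambda>k. a ^ k)" for a :: 'a
    define W where "W = fps_const (c * x powi j) * fps_X"
    have geo: "G (c * x powi e) * L e = 1" for e
      unfolding G_def L_def by (rule fps_geometric)
    \<comment> \<open>A difference of two geometric series with ratios \<open>c * x powi j\<close>
      and \<open>y\<close> times that. Their constant terms cancel, in accordance with
      \<open>R0\<close>.\<close>
    have R_eq: "R j = fps_const (1 / (c * (1 - y))) * (G (c * x powi j) - G (c * x powi (j + (2 * int d - 1))))"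
    proof (rule fps_ext)
      fix k
      show "fps_nth (R j) k = fps_nth (fps_const (1 / (c * (1 - y))) *
              (G (c * x powi j) - G (c * x powi (j + (2 * int d - 1))))) k"
      proof (cases k)
        case 0
        thus ?thesis by (simp add: R0 G_def)
      next
        case (Suc m)
        have 1: "x powi (j * int k) = (x powi j) ^ k"
          by (simp add: power_int_mult)
        have 2: "x ^ (k * (2 * d - 1)) = y ^ k"
          unfolding y_def by (simp add: mult.commute flip: power_mult)
        have 3: "c ^ k = c * (x ^ (2 * m) / ((1 - x ^ 2) ^ m * (1 - x ^ (2 * d + 1)) ^ m))"
          by (simp add: Suc c_def power_divide power_mult_distrib flip: power_mult)
        have p: "x powi (j + (2 * int d - 1)) = x powi j * y"
          using x power_int_add[of x j "2 * int d - 1"] by (simp add: xy)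
        have "fps_nth (R j) k = x ^ (2 * m) / ((1 - x ^ 2) ^ m * (1 - x ^ (2 * d + 1)) ^ m) *
                 ((x powi j) ^ k * (1 - y ^ k)) / (1 - y)"
          using R[of k j] unfolding 1 2 by (simp add: Suc y_def mult_ac del: power_Suc)
        also have "\<dots> = 1 / (c * (1 - y)) * (c ^ k * (x powi j) ^ k * (1 - y ^ k))"
          unfolding 3 using c by simp
        also have "\<dots> = 1 / (c * (1 - y)) * ((c * x powi j) ^ k - (c * x powi (j + (2 * int d - 1))) ^ k)"
          unfolding p power_mult_distrib by (simp add: algebra_simps diff_divide_distrib)
        finally show ?thesis by (simp add: G_def)
      qed
    qed
    have "R j * (L j * L (j + (2 * int d - 1))) =
           fps_const (1 / (c * (1 - y))) *
             ((G (c * x powi j) * L j) * L (j + (2 * int d - 1)) -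
              (G (c * x powi (j + (2 * int d - 1))) * L (j + (2 * int d - 1))) * L j)"
      unfolding R_eq by (simp only: left_diff_distrib right_diff_distrib mult_ac)
    also have "\<dots> = fps_const (1 / (c * (1 - y))) * (L (j + (2 * int d - 1)) - L (j + 0))"
      unfolding geo by simp
    also have "\<dots> = fps_const (1 / (c * (1 - y))) * (fps_const (1 - y) * W)"
      unfolding L_shift xy W_def[symmetric] by (simp add: left_diff_distrib flip: fps_const_sub)
    also have "\<dots> = fps_const (1 / c) * W"
      unfolding mult.assoc[symmetric] fps_const_mult using y by simp
    finally have RLL: "R j * (L j * L (j + (2 * int d - 1))) = fps_const (1 / c) * W" .
    have "1 / c = (1 - x ^ 2) * (1 - x ^ 2 * y) / x ^ 2"
      unfolding c_def y' by simp
    hence c_eq: "1 / x ^ 2 + x ^ 2 * y = 1 + y + 1 / c"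
      using x by (simp add: field_simps power2_eq_square)
    \<comment> \<open>Here the second quadratic is absent and the linear correction is
      \<open>1 / c\<close>. By \<open>c_eq\<close> it is exactly what separates the linear
      coefficients of the two products.\<close>
    have "1 * ((1 - fps_const (x powi - 2) * W) * (1 - fps_const (x powi (2 + (2 * int d - 1))) * W)) =
          1 * ((1 - fps_const (x powi 0) * W) * (1 - fps_const (x powi (2 * int d - 1)) * W)) +
          0 * ((1 - 0 * W) * (1 - 0 * W)) - fps_const (1 / c) * W"
    proof (rule factored_quadratic_eqI)
      show "1 * (fps_const (x powi - 2) + fps_const (x powi (2 + (2 * int d - 1)))) =
            1 * (fps_const (x powi 0) + fps_const (x powi (2 * int d - 1))) + 0 * (0 + 0) + fps_const (1 / c)"
        unfolding xy e4 e3 using c_eq by simp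
      show "1 * (fps_const (x powi - 2) * fps_const (x powi (2 + (2 * int d - 1)))) =
            1 * (fps_const (x powi 0) * fps_const (x powi (2 * int d - 1))) + 0 * (0 * 0)"
        unfolding xy e4 e3 using x by simp
    qed simp
    hence "L (j + - 2) * L (j + (2 + (2 * int d - 1))) =
           L (j + 0) * L (j + (2 * int d - 1)) - fps_const (1 / c) * W"
      unfolding L_shift W_def[symmetric] by simp
    thus ?thesis using RLL by (simp add: left_diff_distrib add.assoc)
  qed
  define P where "P = (\<Prod>l=1..d. (1 - R (j + 2 * int l - 1)) * (1 - R (j - 2 * int l + 1)))"
  have "P * (L (j + 2 * int d - 1) * L (j - 2 * int d + 1 + (2 * int d - 1))) =
        L (j - 2 * int d - 1) * L (j + 2 * int d + 1 + (2 * int d - 1))"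
    unfolding P_def
    by (rule prod_two_sided_telescope[of "\<lambda>j. 1 - R j" L "\<lambda>j. L (j + (2 * int d - 1))"])
       (use F Lnz in auto)
  \<comment> \<open>With \<open>M\<close> the shift of \<open>L\<close> by 2d-1, the surviving
    denominator is \<open>L j * L (j + (2 * int d - 1))\<close>, the same as that of
    \<open>1 - R j\<close>. The functional equation thus becomes an identity between quadratics in
    \<open>W\<close>.\<close>
  hence P: "P * (L (j + 0) * L (j + (2 * int d - 1))) = L (j + (- 1 - 2 * int d)) * L (j + 4 * int d)"
    by (simp add: algebra_simps)
  have Tz: "z * T ^ (2 * d) = T - 1" using T by (simp add: algebra_simps)
  define W where "W = fps_const (c * x powi j) * fps_X"
  have e1: "x powi (- 1 - 2 * int d) = 1 / (x ^ 2 * y)"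
    using power_int_minus_divide[of x "int (2 * d + 1)"] unfolding power_int_of_nat y' by simp
  have "x ^ (4 * d) = x ^ (2 * d + 1) * x ^ (2 * d - 1)"
    using d unfolding power_add[symmetric] by (intro arg_cong[of _ _ "power x"]) simp
  hence e2: "x powi (4 * int d) = x ^ 2 * y ^ 2"
    using power_int_of_nat[of x "4 * d"] unfolding y' y_def[symmetric] by (simp add: power2_eq_square)
  define S where "S = (\<Sum>l=1..d. x powi (2 * int l - 1) + x powi (- (2 * int l) + 1))"
  \<comment> \<open>The extra factor \<open>T\<close> completes \<open>T ^ (2 * d)\<close>, so that
    \<open>Tz\<close> eliminates \<open>z\<close> from the characteristic equation.\<close>
  have "T * 1 = T * (z * T ^ (2 * d - 1) * S)" using char by (simp add: S_def)
  also have "\<dots> = (z * (T * T ^ (2 * d - 1))) * S" by (simp add: mult_ac)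
  also have "T * T ^ (2 * d - 1) = T ^ (2 * d)" using d by (cases d) simp_all
  finally have TS: "T = (T - 1) * S" unfolding Tz by simp
  have p: "x powi (2 * int d) = x * y"
    using x power_int_add[of x 1 "2 * int d - 1"] by (simp add: xy)
  have "S * (x - inverse x) = x * y - 1 / (x * y)"
    unfolding S_def sum_powi_telescope[OF x(1)]
    using p power_int_minus_divide[of x "2 * int d"] by simp
  hence "T * (x - inverse x) = (T - 1) * (x * y - 1 / (x * y))"
    using TS by (metis mult.assoc)
  hence "T * ((x - inverse x) * (x * y)) = (T - 1) * ((x * y - 1 / (x * y)) * (x * y))"
    by (simp only: mult.assoc[symmetric])
  moreover have "(x - inverse x) * (x * y) = x ^ 2 * y - y" "(x * y - 1 / (x * y)) * (x * y) = x ^ 2 * y ^ 2 - 1"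
    using x y by (simp_all add: left_diff_distrib power2_eq_square)
  ultimately have E: "T * (x ^ 2 * y - y) = (T - 1) * (x ^ 2 * y ^ 2 - 1)"
    by (simp only:)
  \<comment> \<open>\<open>E\<close> rearranges to
    \<open>T * (1 - y) * (1 + x ^ 2 * y) = 1 - x ^ 2 * y ^ 2\<close>; multiplied by
    \<open>1 - x ^ 2 * y\<close> it becomes the equality of these numerators.\<close>
  have "T * (y + x ^ 4 * y ^ 2) / (x ^ 2 * y) =
        ((1 + y) * (x ^ 2 * y) + (T - 1) * (1 + x ^ 4 * y ^ 3)) / (x ^ 2 * y)"
    by (rule arg_cong[of _ _ "\<lambda>u. u / (x ^ 2 * y)"]) (use E in algebra)
  moreover have "(y + x ^ 4 * y ^ 2) / (x ^ 2 * y) = 1 / x ^ 2 + x ^ 2 * y"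
    "(1 + x ^ 4 * y ^ 3) / (x ^ 2 * y) = 1 / (x ^ 2 * y) + x ^ 2 * y ^ 2"
    "(1 + y) * (x ^ 2 * y) / (x ^ 2 * y) = 1 + y"
    using x y by (simp_all add: add_divide_distrib power2_eq_square power3_eq_cube power4_eq_xxxx)
  ultimately have E': "T * (1 / x ^ 2 + x ^ 2 * y) = 1 * (1 + y) + (T - 1) * (1 / (x ^ 2 * y) + x ^ 2 * y ^ 2)"
    by (simp only: add_divide_distrib times_divide_eq_right[symmetric] mult_1)
  \<comment> \<open>The functional equation with denominators cleared. Its coefficient of
    \<open>W\<close> is \<open>E'\<close>; in the coefficient of \<open>W * W\<close> all three
    exponent pairs add up to 2d-1.\<close>
  have "fps_const T * ((1 - fps_const (x powi - 2) * W) * (1 - fps_const (x powi (2 + (2 * int d - 1))) * W)) =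
        1 * ((1 - fps_const (x powi 0) * W) * (1 - fps_const (x powi (2 * int d - 1)) * W)) +
        fps_const (T - 1) * ((1 - fps_const (x powi (- 1 - 2 * int d)) * W) * (1 - fps_const (x powi (4 * int d)) * W)) - 0 * W"
  proof (rule factored_quadratic_eqI)
    show "fps_const T = 1 + fps_const (T - 1)"
      by (simp flip: fps_const_1_eq_1)
    show "fps_const T * (fps_const (x powi - 2) + fps_const (x powi (2 + (2 * int d - 1)))) =
          1 * (fps_const (x powi 0) + fps_const (x powi (2 * int d - 1))) +
          fps_const (T - 1) * (fps_const (x powi (- 1 - 2 * int d)) + fps_const (x powi (4 * int d))) + 0"
      unfolding xy e1 e2 e3 e4 using E' by simp
    show "fps_const T * (fps_const (x powi - 2) * fps_const (x powi (2 + (2 * int d - 1)))) =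
          1 * (fps_const (x powi 0) * fps_const (x powi (2 * int d - 1))) +
          fps_const (T - 1) * (fps_const (x powi (- 1 - 2 * int d)) * fps_const (x powi (4 * int d)))"
      unfolding xy e1 e2 e3 e4 using x y by (simp add: field_simps power2_eq_square)
  qed
  hence "fps_const T * (L (j + - 2) * L (j + (2 + (2 * int d - 1)))) =
         L (j + 0) * L (j + (2 * int d - 1)) +
         fps_const (T - 1) * (L (j + (- 1 - 2 * int d)) * L (j + 4 * int d))"
    unfolding L_shift W_def[symmetric] by simp
  hence "fps_const T * ((1 - R j) * (L (j + 0) * L (j + (2 * int d - 1)))) =
         L (j + 0) * L (j + (2 * int d - 1)) +
         fps_const (T - 1) * (P * (L (j + 0) * L (j + (2 * int d - 1))))"
    using F[of j] P by (simp add: add.assoc)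
  hence "(L (j + 0) * L (j + (2 * int d - 1))) * (fps_const T * (1 - R j)) =
         (L (j + 0) * L (j + (2 * int d - 1))) * (1 + fps_const (T - 1) * P)"
    by (simp only: distrib_left distrib_right mult_1_left mult_1_right mult_ac)
  hence "fps_const T * (1 - R j) = 1 + fps_const (T - 1) * P"
    using Lnz by simp
  \<comment> \<open>Since \<open>T - 1 = z * T ^ (2 * d)\<close>, there is one \<open>T\<close> for
    each of the 2d factors of \<open>P\<close>, two for each index \<open>l\<close>.\<close>
  also have "fps_const (T - 1) * P = fps_const z * ((fps_const T * fps_const T) ^ d * P)"
    by (simp add: Tz[symmetric] mult.assoc power_mult power2_eq_square flip: fps_const_mult fps_const_power)
  also have "(fps_const T * fps_const T) ^ d * P = (\<Prod>l=1..d. (fps_const T * fps_const T) *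
               ((1 - R (j + 2 * int l - 1)) * (1 - R (j - 2 * int l + 1))))"
    unfolding P_def by (subst prod.distrib) (simp only: prod_constant, simp)
  finally show ?thesis by (simp only: mult_ac)
qed


section \<open>The functional equation\<close>

lemma exponents_0 [simp]: "0 \<in> exponents d"
  by (simp add: exponents_def)

lemma exponents_add: "g \<in> exponents d \<Longrightarrow> h \<in> exponents d \<Longrightarrow> g + h \<in> exponents d"
  using Poly_Mapping.keys_add[of g h] by (auto simp: exponents_def)

lemma exponents_sum_list: "set gs \<subseteq> exponents d \<Longrightarrow> sum_list gs \<in> exponents d"
  by (induction gs) (auto intro: exponents_add)

lemma lookup_sum_list:
  "Poly_Mapping.lookup (sum_list gs) x = (\<Sum>g\<leftarrow>gs. Poly_Mapping.lookup g x)"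
  by (induction gs) (simp_all add: lookup_add)

lemma exponents_axis:
  assumes "n \<in> exponents d" "d \<ge> 1" "card (Poly_Mapping.keys n) < 2"
  obtains l k where "l \<in> {1..2 * d - 1}" "n = Poly_Mapping.single l k"
proof (cases "n = 0")
  case True
  \<comment> \<open>The zero vector is put on axis 1, which exists because \<open>d\<close> is
    positive.\<close>
  thus ?thesis using that[of 1 0] assms(2) by simp
next
  case False
  hence "card (Poly_Mapping.keys n) \<noteq> 0" by simp
  hence "card (Poly_Mapping.keys n) = 1" using assms(3) by linarith
  then obtain l where l: "Poly_Mapping.keys n = {l}" by (rule card_1_singletonE)
  have "n = Poly_Mapping.single l (Poly_Mapping.lookup n l)"
  proof (rule poly_mapping_eqI)
    fix x
    have "Poly_Mapping.lookup n x = 0" if "x \<noteq> l"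
      using l that by (metis in_keys_iff singletonD)
    thus "Poly_Mapping.lookup n x = Poly_Mapping.lookup (Poly_Mapping.single l (Poly_Mapping.lookup n l)) x"
      by (cases "x = l") (auto simp: lookup_single)
  qed
  thus ?thesis using that[of l] l assms(1) by (auto simp: exponents_def)
qed

lemma Xpow_0 [simp]: "Xpow d X j 0 = 1"
  by (simp add: Xpow_def)

lemma Xpow_single:
  assumes "l \<in> {1..2 * d - 1}"
  shows "Xpow d X j (Poly_Mapping.single l k) = X l powi (j * int k)"
proof -
  have "Xpow d X j (Poly_Mapping.single l k) = (\<Prod>i=1..2 * d - 1. if i = l then X l powi (j * int k) else 1)"
    unfolding Xpow_def by (rule prod.cong) (auto simp: lookup_single)
  thus ?thesis using assms by simp
qed

text \<open>Shows the sum in the recursion factor to be the characteristic sum evaluated at the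
  single element \<open>Xpow d X 1 n\<close>.\<close>

lemma Xpow_conv_powi: "Xpow d X j n = Xpow d X 1 n powi j"
proof -
  have *: "(\<Prod>i\<in>A. f i) powi j = (\<Prod>i\<in>A. f i powi j)" for f :: "nat \<Rightarrow> complex puiseux" and A
    by (induction A rule: infinite_finite_induct) (simp_all add: power_int_mult_distrib)
  show ?thesis
    unfolding Xpow_def * power_int_mult[symmetric] by (simp add: mult.commute)
qed

context
  fixes d :: nat and X :: "nat \<Rightarrow> complex puiseux"
  assumes X_nonzero: "\<And>l. l \<in> {1..2 * d - 1} \<Longrightarrow> X l \<noteq> 0"
begin

lemma Xpow_nonzero: "Xpow d X j n \<noteq> 0"
  using X_nonzero by (auto simp: Xpow_def power_int_eq_0_iff)

lemma Xpow_add_left: "Xpow d X (i + j) n = Xpow d X i n * Xpow d X j n"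
  using Xpow_nonzero[of 1 n] unfolding Xpow_conv_powi[of d X "_ + _"] Xpow_conv_powi[of d X i] Xpow_conv_powi[of d X j]
  by (simp add: power_int_add)

lemma Xpow_add_right: "Xpow d X j (g + h) = Xpow d X j g * Xpow d X j h"
  unfolding Xpow_def prod.distrib[symmetric]
  by (rule prod.cong) (use X_nonzero in \<open>auto simp: lookup_add distrib_left power_int_add\<close>)

lemma Xpow_sum_list: "Xpow d X j (sum_list gs) = (\<Prod>k<length gs. Xpow d X j (gs ! k))"
  by (induction gs) (simp_all add: Xpow_add_right prod.lessThan_Suc_shift del: prod.lessThan_Suc)

text \<open>Expand over increasing tuples and convolve. The factors with exponent \<open>j\<close>
  multiply to \<open>Xpow d X j n\<close> for every tuple, and since \<open>a 0 = 0\<close> only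
  lists of nonzero vectors contribute. What remains has the form of the right side of the
  recursion.\<close>

lemma mfps_nth_prod_B_set:
  fixes a :: "(nat \<Rightarrow>\<^sub>0 nat) \<Rightarrow> complex puiseux" and \<rho> :: "int \<Rightarrow> (nat, complex puiseux) mfps"
  assumes \<rho>: "\<And>i n. mfps_nth (\<rho> i) n = (if n \<in> exponents d then a n * Xpow d X i n else 0)"
    and a0: "a 0 = 0"
  shows "mfps_nth (\<Prod>b\<in>B_set (2 * d). 1 - \<rho> (j + b)) n = Xpow d X j n *
    (\<Sum>l\<le>2 * d. (- 1) ^ l * (\<Sum>gs\<in>tuples_summing_to d l n. (\<Prod>k<l. a (gs ! k)) *
       (\<Sum>bs\<in>increasing_tuples l (B_set (2 * d)). \<Prod>k<l. Xpow d X (bs ! k) (gs ! k))))"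
proof -
  have tuples: "mfps_nth (\<Prod>k<l. \<rho> (j + bs ! k)) n = Xpow d X j n *
      (\<Sum>gs\<in>tuples_summing_to d l n. (\<Prod>k<l. a (gs ! k)) * (\<Prod>k<l. Xpow d X (bs ! k) (gs ! k)))"
    for l and bs :: "int list"
  proof -
    have "mfps_nth (\<Prod>k<l. \<rho> (j + bs ! k)) n =
        (\<Sum>gs | length gs = l \<and> sum_list gs = n. \<Prod>k<l. mfps_nth (\<rho> (j + bs ! k)) (gs ! k))"
      by (rule mfps_nth_prod_lessThan)
    also have "\<dots> = (\<Sum>gs\<in>tuples_summing_to d l n. Xpow d X j n *
                      ((\<Prod>k<l. a (gs ! k)) * (\<Prod>k<l. Xpow d X (bs ! k) (gs ! k))))"
    proof (rule sum.mono_neutral_cong_right)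
      show "finite {gs. length gs = l \<and> sum_list gs = n}"
        by (rule finite_lists_sum_exponent)
      show "tuples_summing_to d l n \<subseteq> {gs. length gs = l \<and> sum_list gs = n}"
        by (auto simp: tuples_summing_to_def)
      show "\<forall>gs\<in>{gs. length gs = l \<and> sum_list gs = n} - tuples_summing_to d l n.
              (\<Prod>k<l. mfps_nth (\<rho> (j + bs ! k)) (gs ! k)) = 0"
      proof
        fix gs assume gs: "gs \<in> {gs. length gs = l \<and> sum_list gs = n} - tuples_summing_to d l n"
        then obtain g where "g \<in> set gs" "g \<notin> exponents d \<or> g = 0"
          by (auto simp: tuples_summing_to_def)
        then obtain k where "k < l" "gs ! k \<notin> exponents d \<or> gs ! k = 0"
          using gs by (auto simp: in_set_conv_nth)
        thus "(\<Prod>k<l. mfps_nth (\<rho> (j + bs ! k)) (gs ! k)) = 0"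
          by (intro prod_zero bexI[of _ k]) (auto simp: \<rho> a0)
      qed
      fix gs assume gs: "gs \<in> tuples_summing_to d l n"
      have "(\<Prod>k<l. mfps_nth (\<rho> (j + bs ! k)) (gs ! k)) =
            (\<Prod>k<l. a (gs ! k) * (Xpow d X j (gs ! k) * Xpow d X (bs ! k) (gs ! k)))"
      proof (rule prod.cong[OF refl])
        fix k assume "k \<in> {..<l}"
        hence "gs ! k \<in> exponents d"
          using gs nth_mem[of k gs] by (auto simp: tuples_summing_to_def simp del: nth_mem)
        thus "mfps_nth (\<rho> (j + bs ! k)) (gs ! k) =
              a (gs ! k) * (Xpow d X j (gs ! k) * Xpow d X (bs ! k) (gs ! k))"
          by (simp add: \<rho> Xpow_add_left)
      qed
      also have "\<dots> = Xpow d X j n * ((\<Prod>k<l. a (gs ! k)) * (\<Prod>k<l. Xpow d X (bs ! k) (gs ! k)))"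
        using gs Xpow_sum_list[of j gs] by (simp add: tuples_summing_to_def prod.distrib mult_ac)
      finally show "(\<Prod>k<l. mfps_nth (\<rho> (j + bs ! k)) (gs ! k)) =
            Xpow d X j n * ((\<Prod>k<l. a (gs ! k)) * (\<Prod>k<l. Xpow d X (bs ! k) (gs ! k)))" .
    qed
    finally show ?thesis by (simp only: sum_distrib_left)
  qed
  have "mfps_nth (\<Prod>b\<in>B_set (2 * d). 1 - \<rho> (j + b)) n =
    (\<Sum>l\<le>2 * d. (- 1) ^ l * (\<Sum>bs\<in>increasing_tuples l (B_set (2 * d)). mfps_nth (\<Prod>k<l. \<rho> (j + bs ! k)) n))"
    unfolding prod_one_minus_increasing_tuples[OF finite_B_set] mfps_nth_sum
      mfps_nth_minus_one_power_mult card_B_set ..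
  also have "\<dots> = (\<Sum>l\<le>2 * d. Xpow d X j n * ((- 1) ^ l * (\<Sum>gs\<in>tuples_summing_to d l n. (\<Prod>k<l. a (gs ! k)) *
       (\<Sum>bs\<in>increasing_tuples l (B_set (2 * d)). \<Prod>k<l. Xpow d X (bs ! k) (gs ! k)))))"
    unfolding tuples sum_distrib_left
    by (subst sum.swap) (simp only: mult_ac)
  finally show ?thesis by (simp only: sum_distrib_left)
qed

end

section \<open>The tuples in the recursion\<close>

lemma tuples_summing_to_0: "n \<noteq> 0 \<Longrightarrow> tuples_summing_to d 0 n = {}"
  by (auto simp: tuples_summing_to_def)

lemma tuples_summing_to_1:
  "n \<in> exponents d \<Longrightarrow> n \<noteq> 0 \<Longrightarrow> tuples_summing_to d 1 n = {[n]}"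
  by (auto simp: tuples_summing_to_def length_Suc_conv)

lemma tuples_summing_to_not_exponent:
  "n \<notin> exponents d \<Longrightarrow> tuples_summing_to d l n = {}"
  using exponents_sum_list[of _ d] by (auto simp: tuples_summing_to_def)

lemma sum_increasing_tuples_1: "(\<Sum>bs\<in>increasing_tuples 1 B. f (bs ! 0)) = (\<Sum>b\<in>B. f b)"
  by (rule sum.reindex_bij_witness[where i = "\<lambda>b. [b]" and j = hd])
     (auto simp: increasing_tuples_def length_Suc_conv)

text \<open>Makes the total degree an induction measure for the recursion: besides \<open>g\<close>
  there is another entry, and being nonzero it has positive degree.\<close>

lemma tuples_summing_to_sum_lookup_less:
  assumes "gs \<in> tuples_summing_to d l n" "l \<ge> 2" "g \<in> set gs"
  shows "(\<Sum>i=1..2 * d - 1. Poly_Mapping.lookup g i) < (\<Sum>i=1..2 * d - 1. Poly_Mapping.lookup n i)"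
proof -
  have gs: "length gs = l" "set gs \<subseteq> exponents d - {0}" "sum_list gs = n"
    using assms(1) by (auto simp: tuples_summing_to_def)
  have pos: "(\<Sum>i=1..2 * d - 1. Poly_Mapping.lookup h i) > 0" if "h \<in> exponents d - {0}" for h
  proof -
    have "Poly_Mapping.keys h \<noteq> {}" using that by simp
    then obtain i where i: "i \<in> Poly_Mapping.keys h" by blast
    hence "Poly_Mapping.lookup h i \<le> (\<Sum>i=1..2 * d - 1. Poly_Mapping.lookup h i)"
      using that by (intro member_le_sum) (auto simp: exponents_def)
    moreover have "Poly_Mapping.lookup h i > 0" using i by (simp add: in_keys_iff)
    ultimately show ?thesis by linarith
  qed
  \<comment> \<open>Only one occurrence of \<open>g\<close> is removed, so repeated entries cause no
    trouble.\<close>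
  have "length (remove1 g gs) > 0"
    using assms(2,3) gs(1) by (simp add: length_remove1)
  then obtain h where h: "h \<in> set (remove1 g gs)"
    by (metis last_in_set length_greater_0_conv)
  have "(\<Sum>i=1..2 * d - 1. Poly_Mapping.lookup n i) =
        (\<Sum>h\<leftarrow>gs. \<Sum>i=1..2 * d - 1. Poly_Mapping.lookup h i)"
    unfolding gs(3)[symmetric] lookup_sum_list by (induction gs) (simp_all add: sum.distrib)
  also have "\<dots> = (\<Sum>i=1..2 * d - 1. Poly_Mapping.lookup g i) +
                  (\<Sum>h\<leftarrow>remove1 g gs. \<Sum>i=1..2 * d - 1. Poly_Mapping.lookup h i)"
    by (rule sum_list_map_remove1) fact
  finally have sum_n: "(\<Sum>i=1..2 * d - 1. Poly_Mapping.lookup n i) =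
      (\<Sum>i=1..2 * d - 1. Poly_Mapping.lookup g i) +
      (\<Sum>h\<leftarrow>remove1 g gs. \<Sum>i=1..2 * d - 1. Poly_Mapping.lookup h i)" .
  have "0 < (\<Sum>h\<leftarrow>remove1 g gs. \<Sum>i=1..2 * d - 1. Poly_Mapping.lookup h i)"
  proof -
    have "h \<in> exponents d - {0}" using h gs(2) set_remove1_subset[of g gs] by blast
    hence "0 < (\<Sum>i=1..2 * d - 1. Poly_Mapping.lookup h i)" by (rule pos)
    also have "\<dots> \<le> (\<Sum>h\<leftarrow>remove1 g gs. \<Sum>i=1..2 * d - 1. Poly_Mapping.lookup h i)"
      by (rule member_le_sum_list) (use h in auto)
    finally show ?thesis .
  qed
  thus ?thesis unfolding sum_n by (rule less_add_same_cancel1[THEN iffD2])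
qed

text \<open>\<open>T\<close> has constant term 1 and hence order 0, so only the factor
  \<open>pz\<close> counts.\<close>

lemma puiseux_order_pz_times_power:
  fixes T :: "complex fps"
  assumes "fps_nth T 0 = 1"
  shows "puiseux_order (pz * puiseux_of_fps T ^ m) = 1" "pz * puiseux_of_fps T ^ m \<noteq> 0"
proof -
  have T: "puiseux_of_fps T \<noteq> 0" "puiseux_order (puiseux_of_fps T) = 0"
    using assms by (auto simp: puiseux_of_fls_eq_0_iff puiseux_order_of_fls fls_subdegree_fls_to_fps)
  have z: "pz \<noteq> 0" "puiseux_order pz = 1"
    by (simp_all add: puiseux_of_fls_eq_0_iff puiseux_order_of_fls)
  show "puiseux_order (pz * puiseux_of_fps T ^ m) = 1" "pz * puiseux_of_fps T ^ m \<noteq> 0"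
    using T z by (simp_all add: puiseux_order_mult puiseux_order_power)
qed

text \<open>Small solutions have order \<open>1/(2d-1)\<close>, so a product of at least two of them is too
  small to be a solution itself.\<close>

lemma recursion_factor_nonzero:
  fixes T :: "complex fps"
  assumes T0: "fps_nth T 0 = 1"
    and X: "\<And>l. l \<in> {1..2 * d - 1} \<Longrightarrow> X l \<in> small_solutions d T"
    and n: "n \<in> exponents d" "card (Poly_Mapping.keys n) \<ge> 2"
  shows "- (1 / (pz * puiseux_of_fps T ^ (2 * d - 1))) +
              (\<Sum>l=1..d. Xpow d X (2 * int l - 1) n + Xpow d X (- (2 * int l) + 1) n) \<noteq> 0"
proof
  define w where "w = pz * puiseux_of_fps T ^ (2 * d - 1)"
  define Y where "Y = Xpow d X 1 n"
  have w: "w \<noteq> 0" "puiseux_order w = 1"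
    unfolding w_def using puiseux_order_pz_times_power[OF T0] by blast+
  have ord_X: "of_nat (2 * d - 1) * puiseux_order (X l) = 1" "X l \<noteq> 0" if "l \<in> {1..2 * d - 1}" for l
  proof -
    have "X l \<noteq> 0" "puiseux_order (X l) > 0"
      "1 = w * (\<Sum>i=1..d. X l powi (2 * int i - 1) + X l powi (- (2 * int i) + 1))"
      using X[OF that] unfolding small_solutions_def w_def by blast+
    thus "X l \<noteq> 0" "of_nat (2 * d - 1) * puiseux_order (X l) = 1"
      using puiseux_order_characteristic_solution[of "X l" w d] unfolding w(2) by blast+
  qed
  have Y: "Y \<noteq> 0" unfolding Y_def by (rule Xpow_nonzero) (rule ord_X(2))
  have "puiseux_order Y = (\<Sum>l=1..2 * d - 1. of_nat (Poly_Mapping.lookup n l) * puiseux_order (X l))"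
    unfolding Y_def Xpow_def using ord_X
    by (subst puiseux_order_prod) (auto simp: puiseux_order_power intro!: sum.cong)
  hence "of_nat (2 * d - 1) * puiseux_order Y =
         (\<Sum>l=1..2 * d - 1. of_nat (Poly_Mapping.lookup n l) * (of_nat (2 * d - 1) * puiseux_order (X l)))"
    by (simp add: sum_distrib_left mult_ac)
  also have "\<dots> = (\<Sum>l=1..2 * d - 1. of_nat (Poly_Mapping.lookup n l))"
    by (rule sum.cong[OF refl]) (simp only: ord_X mult_1_right)
  \<comment> \<open>Each small solution contributes 1 after scaling by 2d-1, so the scaled order of
    \<open>Y\<close> is the total degree of \<open>n\<close>.\<close>
  finally have ord_Y: "of_nat (2 * d - 1) * puiseux_order Y = of_nat (\<Sum>l=1..2 * d - 1. Poly_Mapping.lookup n l)"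
    by simp
  have "2 \<le> (\<Sum>l\<in>Poly_Mapping.keys n. 1 :: nat)" using n(2) by simp
  also have "\<dots> \<le> (\<Sum>l\<in>Poly_Mapping.keys n. Poly_Mapping.lookup n l)"
    by (rule sum_mono) (simp add: in_keys_iff Suc_le_eq)
  also have "\<dots> \<le> (\<Sum>l=1..2 * d - 1. Poly_Mapping.lookup n l)"
    using n(1) by (intro sum_mono2) (auto simp: exponents_def)
  finally have ge2: "(\<Sum>l=1..2 * d - 1. Poly_Mapping.lookup n l) \<ge> 2" .
  have "(of_nat (\<Sum>l=1..2 * d - 1. Poly_Mapping.lookup n l) :: rat) > 0"
    using ge2 by (subst of_nat_0_less_iff) linarith
  hence Y_pos: "puiseux_order Y > 0"
    unfolding ord_Y[symmetric] by (simp add: zero_less_mult_iff)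
  \<comment> \<open>If the factor vanished, \<open>Y\<close> would solve the characteristic equation
    and its scaled order would be 1.\<close>
  assume "- (1 / (pz * puiseux_of_fps T ^ (2 * d - 1))) +
              (\<Sum>l=1..d. Xpow d X (2 * int l - 1) n + Xpow d X (- (2 * int l) + 1) n) = 0"
  hence "(\<Sum>l=1..d. Y powi (2 * int l - 1) + Y powi (- (2 * int l) + 1)) = 1 / w"
    unfolding w_def[symmetric] Y_def by (simp only: Xpow_conv_powi[symmetric]) (simp add: add_eq_0_iff)
  hence "1 = w * (\<Sum>l=1..d. Y powi (2 * int l - 1) + Y powi (- (2 * int l) + 1))"
    using w by simp
  hence "of_nat (2 * d - 1) * puiseux_order Y = puiseux_order w"
    by (rule puiseux_order_characteristic_solution[OF Y Y_pos])
  hence "(of_nat (\<Sum>l=1..2 * d - 1. Poly_Mapping.lookup n l) :: rat) = of_nat 1"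
    unfolding ord_Y w(2) by simp
  hence "(\<Sum>l=1..2 * d - 1. Poly_Mapping.lookup n l) = 1" by (simp only: of_nat_eq_iff)
  thus False using ge2 by linarith
qed

text \<open>Each \<open>\<alpha> n\<close> is typed as a full series. That it is a scalar multiple
  of the monomial with exponent \<open>n\<close> is derived from the recursion, and this makes the
  family summed in \<open>\<rho>\<close> locally finite.\<close>

theorem proposition2:
  fixes d :: nat
    and T :: "complex fps"
    and X :: "nat \<Rightarrow> complex puiseux"
    and \<alpha> :: "(nat \<Rightarrow>\<^sub>0 nat) \<Rightarrow> (nat, complex puiseux) mfps"
    and \<rho> TT :: "int \<Rightarrow> (nat, complex puiseux) mfps"
  assumes d: "d \<ge> 1"
    and T0: "fps_nth T 0 = 1"
    and T: "T = 1 + fps_X * T ^ (2 * d)"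
    and X: "bij_betw X {1..2 * d - 1} (small_solutions d T)"
    and alpha_zero: "\<alpha> 0 = 0"
    and alpha_unit: "\<And>l. l \<in> {1..2 * d - 1} \<Longrightarrow> \<alpha> (Poly_Mapping.single l 1) = mfps_var l"
    and alpha_axis: "\<And>l k. l \<in> {1..2 * d - 1} \<Longrightarrow> k \<ge> 1 \<Longrightarrow>
          \<alpha> (Poly_Mapping.single l k) =
            \<alpha> (Poly_Mapping.single l 1) ^ k *
            mfps_const (X l ^ (2 * (k - 1)) * (1 - X l ^ (k * (2 * d - 1))) /
              ((1 - X l ^ (2 * d - 1)) * (1 - X l ^ 2) ^ (k - 1) * (1 - X l ^ (2 * d + 1)) ^ (k - 1)))"
    and alpha_rec: "\<And>n. n \<in> exponents d \<Longrightarrow> card (Poly_Mapping.keys n) \<ge> 2 \<Longrightarrow>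
          \<alpha> n * mfps_const (- (1 / (pz * puiseux_of_fps T ^ (2 * d - 1))) +
              (\<Sum>l=1..d. Xpow d X (2 * int l - 1) n + Xpow d X (- (2 * int l) + 1) n)) =
          (\<Sum>l=2..2 * d. (- 1) ^ l *
             (\<Sum>gs \<in> tuples_summing_to d l n.
                (\<Prod>k<l. \<alpha> (gs ! k)) *
                mfps_const (\<Sum>bs \<in> increasing_tuples l (B_set (2 * d)).
                  \<Prod>k<l. Xpow d X (bs ! k) (gs ! k))))"
    and rho: "\<And>j. \<rho> j =
          mfps_formal_sum (\<lambda>n. \<alpha> n * mfps_const (Xpow d X j n)) (exponents d)"
    and TT: "\<And>j. TT j = mfps_const (puiseux_of_fps T) * (1 - \<rho> j)"
  shows "\<forall>j. TT j = 1 + mfps_const pz *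
           (\<Prod>l=1..d. TT (j + 2 * int l - 1) * TT (j - 2 * int l + 1))"
proof -
  define t where "t = puiseux_of_fps T"
  define w where "w = pz * t ^ (2 * d - 1)"
  \<comment> \<open>The scalar in front of the monomial, once \<open>\<alpha> n\<close> is known to
    be a single term.\<close>
  define a where "a n = mfps_nth (\<alpha> n) n" for n
  define D where "D n = - (1 / w) +
      (\<Sum>l=1..d. Xpow d X (2 * int l - 1) n + Xpow d X (- (2 * int l) + 1) n)" for n
  have Xs: "X l \<in> small_solutions d T" if "l \<in> {1..2 * d - 1}" for l
    using bij_betw_apply[OF X that] .
  hence X_nonzero: "X l \<noteq> 0" if "l \<in> {1..2 * d - 1}" for l
    using that by (auto simp: small_solutions_def)
  have w: "w \<noteq> 0" unfolding w_def t_def by (rule puiseux_order_pz_times_power[OF T0])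
  have t_pow: "pz * t ^ (2 * d) = t * w"
    using d by (cases d) (simp_all add: w_def mult_ac)
  have "fps_to_fls (1 + fps_X * T ^ (2 * d)) = 1 + fls_X * fps_to_fls T ^ (2 * d)"
    by (simp add: fls_times_fps_to_fls fps_to_fls_power)
  hence "fps_to_fls T = 1 + fls_X * fps_to_fls T ^ (2 * d)"
    using T by simp
  from arg_cong[OF this, of puiseux_of_fls] have t: "t = 1 + pz * t ^ (2 * d)"
    unfolding t_def puiseux_of_fls_add puiseux_of_fls_1 puiseux_of_fls_mult puiseux_of_fls_power .

  \<comment> \<open>Homogeneity of the coefficients\<close>
  have "\<exists>c. \<alpha> n = mfps_monom n c" if "n \<in> exponents d" for n
    using that
  \<comment> \<open>Induction on the total degree. The recursion has only tuples with at least two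
    entries, so every \<open>gs ! k\<close> has smaller degree.\<close>
  proof (induction "\<Sum>i=1..2 * d - 1. Poly_Mapping.lookup n i" arbitrary: n rule: less_induct)
    case (less n)
    show ?case
    proof (cases "card (Poly_Mapping.keys n) < 2")
      case True
      then obtain l k where l: "l \<in> {1..2 * d - 1}" and n: "n = Poly_Mapping.single l k"
        using exponents_axis[OF less.prems d] by metis
      show ?thesis
      proof (cases "k = 0")
        case True
        hence "\<alpha> n = mfps_monom n 0" using n alpha_zero by simp
        thus ?thesis by blast
      next
        case False
        hence "k \<ge> 1" by simp
        show ?thesis
          unfolding n alpha_axis[OF l \<open>k \<ge> 1\<close>] alpha_unit[OF l] mfps_var_conv_monom mfps_monom_single_power
            mfps_const_conv_monom mfps_monom_mult add_0_right by blast
      qed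
    next
      case False
      hence card: "card (Poly_Mapping.keys n) \<ge> 2" by simp
      have prod: "(\<Prod>k<l. \<alpha> (gs ! k)) = mfps_monom n (\<Prod>k<l. a (gs ! k))"
        if l: "l \<ge> 2" and gs: "gs \<in> tuples_summing_to d l n" for l gs
      proof -
        have len: "length gs = l" "sum_list gs = n" using gs by (auto simp: tuples_summing_to_def)
        have "\<alpha> (gs ! k) = mfps_monom (gs ! k) (a (gs ! k))" if "k < l" for k
        proof -
          have mem: "gs ! k \<in> set gs" using that len by simp
          hence "gs ! k \<in> exponents d" using gs by (auto simp: tuples_summing_to_def)
          then obtain c where "\<alpha> (gs ! k) = mfps_monom (gs ! k) c"
            using less.hyps[OF tuples_summing_to_sum_lookup_less[OF gs l mem]] by blast
          thus ?thesis by (simp add: a_def mfps_nth_monom)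
        qed
        hence "(\<Prod>k<l. \<alpha> (gs ! k)) = (\<Prod>k<l. mfps_monom (gs ! k) (a (gs ! k)))" by simp
        thus ?thesis using mfps_monom_prod_nth[of gs a] len by simp
      qed
      obtain q where q: "\<alpha> n * mfps_const (D n) = mfps_monom n q"
      proof
        have "\<alpha> n * mfps_const (D n) = (\<Sum>l=2..2 * d. (- 1) ^ l *
             (\<Sum>gs \<in> tuples_summing_to d l n. mfps_monom n (\<Prod>k<l. a (gs ! k)) *
                mfps_const (\<Sum>bs \<in> increasing_tuples l (B_set (2 * d)).
                  \<Prod>k<l. Xpow d X (bs ! k) (gs ! k))))"
          unfolding D_def w_def t_def alpha_rec[OF less.prems card]
          by (intro sum.cong refl arg_cong2[of _ _ _ _ "(*)"] prod) auto
        thus "\<alpha> n * mfps_const (D n) = mfps_monom n (\<Sum>l=2..2 * d. (- 1) ^ l *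
             (\<Sum>gs \<in> tuples_summing_to d l n. (\<Prod>k<l. a (gs ! k)) *
                (\<Sum>bs \<in> increasing_tuples l (B_set (2 * d)). \<Prod>k<l. Xpow d X (bs ! k) (gs ! k))))"
          by (simp only: mfps_const_conv_monom mfps_monom_mult mfps_monom_sum
              mfps_minus_one_power_mult_monom add_0_right)
      qed
      have "D n \<noteq> 0"
        unfolding D_def w_def t_def using T0 Xs less.prems card by (rule recursion_factor_nonzero)
      \<comment> \<open>The recursion determines only the product of \<open>\<alpha> n\<close> with
        the constant \<open>D n\<close>; its nonvanishing allows division.\<close>
      hence "\<alpha> n = (\<alpha> n * mfps_const (D n)) * mfps_const (1 / D n)"
        by (simp add: mult.assoc mfps_const_mult) (simp add: mfps_const_conv_monom mfps_monom_0_1)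
      also have "\<dots> = mfps_monom n (q * (1 / D n))"
        unfolding q by (simp add: mfps_const_conv_monom mfps_monom_mult)
      finally show ?thesis by blast
    qed
  qed
  hence alpha_monom: "\<alpha> n = mfps_monom n (a n)" if "n \<in> exponents d" for n
    using that by (metis a_def mfps_nth_monom)
  have a0: "a 0 = 0" by (simp add: a_def alpha_zero)

  \<comment> \<open>The coefficients of \<open>\<rho>\<close>\<close>
  have rho_nth: "mfps_nth (\<rho> j) n = (if n \<in> exponents d then a n * Xpow d X j n else 0)" for j n
  proof -
    have *: "mfps_nth (\<alpha> i * mfps_const (Xpow d X j i)) n = (if n = i then a i * Xpow d X j i else 0)"
      if "i \<in> exponents d" for i
      by (simp add: alpha_monom[OF that] mfps_nth_mult_const mfps_nth_monom)
    have "mfps_nth (\<rho> j) n = (\<Sum>i | i \<in> exponents d \<and> mfps_nth (\<alpha> i * mfps_const (Xpow d X j i)) n \<noteq> 0.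
            mfps_nth (\<alpha> i * mfps_const (Xpow d X j i)) n)"
      unfolding rho mfps_formal_sum.rep_eq ..
    \<comment> \<open>A term indexed by \<open>i\<close> lives at the monomial \<open>i\<close>
      only, so at most \<open>i = n\<close> contributes.\<close>
    also have "\<dots> = (\<Sum>i\<in>exponents d \<inter> {n}. if n = i then a i * Xpow d X j i else 0)"
      by (rule sum.mono_neutral_cong_left) (auto simp: * split: if_splits)
    finally show ?thesis by auto
  qed

  \<comment> \<open>Comparison of coefficients in the functional equation\<close>
  show ?thesis
  proof
    fix j
    define P where "P = (\<Prod>b\<in>B_set (2 * d). 1 - \<rho> (j + b))"
    have "(\<Prod>l=1..d. TT (j + 2 * int l - 1) * TT (j - 2 * int l + 1)) = (\<Prod>b\<in>B_set (2 * d). TT (j + b))"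
      unfolding prod_B_set by (simp add: algebra_simps)
    also have "\<dots> = mfps_const (t ^ (2 * d)) * P"
      by (simp add: TT P_def prod.distrib card_B_set mfps_const_power t_def)
    finally have prod_TT: "mfps_const pz * (\<Prod>l=1..d. TT (j + 2 * int l - 1) * TT (j - 2 * int l + 1)) =
        mfps_const (t * w) * P"
      by (simp add: mfps_const_mult t_pow flip: mult.assoc)
    show "TT j = 1 + mfps_const pz * (\<Prod>l=1..d. TT (j + 2 * int l - 1) * TT (j - 2 * int l + 1))"
      unfolding mfps_eq_iff
    proof
      fix n
      show "mfps_nth (TT j) n = mfps_nth (1 + mfps_const pz *
              (\<Prod>l=1..d. TT (j + 2 * int l - 1) * TT (j - 2 * int l + 1))) n"
      \<comment> \<open>The positive case includes \<open>n = 0\<close>. The other one consists of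
        the vectors governed by the recursion and of those using foreign indeterminates, where both
        sides vanish.\<close>
      proof (cases "n \<in> exponents d \<and> card (Poly_Mapping.keys n) < 2")
        case True
        then obtain l k where l: "l \<in> {1..2 * d - 1}" and n: "n = Poly_Mapping.single l k"
          using exponents_axis[of n d] d by metis
        have axis_exp: "Poly_Mapping.single l i \<in> exponents d" for i
          using l by (auto simp: exponents_def)
        have ord_X: "puiseux_order (X l) > 0"
          using Xs[OF l] by (simp add: small_solutions_def)
        have X_power: "X l ^ m \<noteq> 1" if "m > 0" for m
          using puiseux_order_1_minus(1)[of "X l ^ m"] ord_X that X_nonzero[OF l]
          by (auto simp: puiseux_order_power)
        \<comment> \<open>Restriction to axis \<open>l\<close> is multiplicative and keeps the
          coefficient at \<open>n\<close>, so the univariate equation for the restricted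
          \<open>\<rho>\<close> suffices.\<close>
        have "fps_const t * (1 - mfps_axis l (\<rho> j)) = 1 + fps_const pz *
           (\<Prod>i=1..d. (fps_const t * (1 - mfps_axis l (\<rho> (j + 2 * int i - 1)))) *
                      (fps_const t * (1 - mfps_axis l (\<rho> (j - 2 * int i + 1)))))"
        proof (rule functional_equation_one_variable[OF d])
          show "X l \<noteq> 0" "X l ^ 2 \<noteq> 1" "X l ^ (2 * d - 1) \<noteq> 1" "X l ^ (2 * d + 1) \<noteq> 1"
            by (rule X_nonzero[OF l]) (rule X_power, use d in simp)+
          show "t = 1 + pz * t ^ (2 * d)" by (rule t)
          show "1 = pz * t ^ (2 * d - 1) *
            (\<Sum>i=1..d. X l powi (2 * int i - 1) + X l powi (- (2 * int i) + 1))"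
            using Xs[OF l] unfolding small_solutions_def t_def by blast
          show "fps_nth (mfps_axis l (\<rho> i)) 0 = 0" for i
            by (simp add: fps_nth_mfps_axis rho_nth a0)
          show "fps_nth (mfps_axis l (\<rho> i)) m =
              X l ^ (2 * (m - 1)) * (1 - X l ^ (m * (2 * d - 1))) /
              ((1 - X l ^ (2 * d - 1)) * (1 - X l ^ 2) ^ (m - 1) * (1 - X l ^ (2 * d + 1)) ^ (m - 1)) *
              X l powi (i * int m)" if "m \<ge> 1" for i m
            unfolding fps_nth_mfps_axis rho_nth a_def alpha_axis[OF l that] alpha_unit[OF l]
              mfps_var_conv_monom mfps_monom_single_power mfps_nth_mult_const Xpow_single[OF l]
            using axis_exp by (simp only: mfps_nth_monom refl if_True mult_1_left)
        qed
        hence "mfps_axis l (TT j) = mfps_axis l (1 + mfps_const pz *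
                 (\<Prod>l=1..d. TT (j + 2 * int l - 1) * TT (j - 2 * int l + 1)))"
          by (simp add: TT t_def mfps_axis_prod)
        thus ?thesis unfolding n fps_nth_mfps_axis[symmetric] by simp
      next
        case non_axis: False
        define S where "S l = (- 1) ^ l * (\<Sum>gs\<in>tuples_summing_to d l n. (\<Prod>k<l. a (gs ! k)) *
            (\<Sum>bs\<in>increasing_tuples l (B_set (2 * d)). \<Prod>k<l. Xpow d X (bs ! k) (gs ! k)))" for l
        have P_nth: "mfps_nth P n = Xpow d X j n * (\<Sum>l\<le>2 * d. S l)"
          unfolding P_def S_def by (rule mfps_nth_prod_B_set[OF X_nonzero rho_nth a0])
        have n0: "n \<noteq> 0" using non_axis by auto
        \<comment> \<open>For \<open>n \<noteq> 0\<close> the constant 1 is invisible: the left side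
          contributes \<open>- t\<close> times the coefficient of \<open>\<rho> j\<close>, the right
          side \<open>t * w\<close> times that of \<open>P\<close>.\<close>
        have "mfps_nth (\<rho> j) n = - (w * mfps_nth P n)"
        proof (cases "n \<in> exponents d")
          case False
          thus ?thesis by (simp add: rho_nth P_nth S_def tuples_summing_to_not_exponent)
        next
          case n: True
          hence card: "card (Poly_Mapping.keys n) \<ge> 2" using non_axis by simp
          have "(\<Sum>l=2..2 * d. S l) = mfps_nth (\<alpha> n * mfps_const (D n)) n"
          proof -
            have "mfps_nth (\<Prod>k<l. \<alpha> (gs ! k)) n = (\<Prod>k<l. a (gs ! k))"
              if gs: "gs \<in> tuples_summing_to d l n" for l gs
            proof -
              have len: "length gs = l" "sum_list gs = n" "set gs \<subseteq> exponents d"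
                using gs by (auto simp: tuples_summing_to_def)
              have "(\<Prod>k<l. \<alpha> (gs ! k)) = (\<Prod>k<l. mfps_monom (gs ! k) (a (gs ! k)))"
                by (rule prod.cong[OF refl]) (use len alpha_monom nth_mem in blast)
              thus ?thesis using mfps_monom_prod_nth[of gs a] len by (simp add: mfps_nth_monom)
            qed
            thus ?thesis
              unfolding D_def w_def t_def alpha_rec[OF n card] S_def
              by (simp only: mfps_nth_sum mfps_nth_minus_one_power_mult mfps_nth_mult_const cong: sum.cong)
          qed
          hence S_ge_2: "(\<Sum>l=2..2 * d. S l) = a n * D n"
            by (simp add: mfps_nth_mult_const a_def)
          have "S 0 = 0" by (simp add: S_def tuples_summing_to_0[OF n0])
          moreover have "S 1 = - (a n * (\<Sum>b\<in>B_set (2 * d). Xpow d X b n))"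
            unfolding S_def tuples_summing_to_1[OF n n0]
            using sum_increasing_tuples_1[of "\<lambda>b. Xpow d X b n" "B_set (2 * d)"] by simp
          moreover have "{..2 * d} = insert 0 (insert 1 {2..2 * d})" using d by auto
          \<comment> \<open>The empty tuple contributes nothing, and the tuples of length 1 cancel
            the sum over \<open>B_set (2 * d)\<close> inside \<open>D n\<close>, so that only its
            summand \<open>- (1 / w)\<close> survives.\<close>
          ultimately have "(\<Sum>l\<le>2 * d. S l) = a n * D n - a n * (\<Sum>b\<in>B_set (2 * d). Xpow d X b n)"
            using S_ge_2 by simp
          also have "\<dots> = - (a n / w)"
            unfolding D_def sum_B_set by (simp add: algebra_simps)
          finally have "(\<Sum>l\<le>2 * d. S l) = - (a n / w)" .
          thus ?thesis using n w by (simp add: P_nth rho_nth)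
        qed
        thus ?thesis
          unfolding prod_TT unfolding TT t_def[symmetric] using n0
          by (simp add: mfps_nth_const_mult mfps_nth_1)
      qed
    qed
  qed
qed

end
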